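(* Let $K$ be an algebraically closed field of characteristic zero, $R=K[X,Y]$, $\mathfrak{m}=(X,Y)$, $R_{\mathfrak{m}}=K[X,Y]_{(X,Y)}$. Let $m,n$ be positive integers and let $H_{i,j,t,x}$ be a subgroup of $\mathbb{U}_m\times\mathbb{U}_n$ (with $i,j,t,x$ admissible parameters). 1) There exists a rational rank $1$ non discrete valuation $\nu$ of $K(X,Y)$ dominating $R_{\mathfrak{m}}$ whose generating sequence $Q_0=X,\ Q_1=Y,\ Q_2,\dots$ consists of eigenfunctions for $H_{i,j,t,x}$ if and only if $\gcd(\frac{m}{i},\frac{n}{j})=t$. 2) If $\gcd(\frac{m}{i},\frac{n}{j})=t=1$, then $S^{R_{\mathfrak{m}}}(\nu)$ is a finitely generated $S^{(A_{i,j,t,x})_{\mathfrak{n}}}(\nu)$-module for all rational rank $1$ non discrete valuations $\nu$ which dominate $R_{\mathfrak{m}}$ and whose generating sequence consists of eigenfunctions for $H_{i,j,t,x}$. 3) If $\gcd(\frac{m}{i},\frac{n}{j})=t>1$, then $S^{R_{\mathfrak{m}}}(\nu)$ is not a finitely generated $S^{(A_{i,j,t,x})_{\mathfrak{n}}}(\nu)$-module for all rational rank $1$ non discrete valuations $\nu$ which dominate $R_{\mathfrak{m}}$ and whose generating sequence consists of eigenfunctions for $H_{i,j,t,x}$ (that is, for every such $\nu$, finite generation fails).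
   Context: $\mathbb{N}=\{0,1,2,\dots\}$. Groups. Let $\alpha\in K$ be a primitive $m$-th root of unity, $\beta\in K$ a primitive $n$-th root of unity, $\mathbb{U}_m=\langle\alpha\rangle$, $\mathbb{U}_n=\langle\beta\rangle$. Positive integers $i,j,t,x$ are admissible if $i\mid m$, $j\mid n$, $t\mid \frac{m}{i}$, $t\mid\frac{n}{j}$, $\gcd(x,t)=1$ and $1\le x\le t$. For these, $H_{i,j,t,x}=\{(\alpha^{ai},\beta^{bj}) : a,b\in\mathbb{Z},\ b\equiv ax \pmod t\}$, a subgroup of $\mathbb{U}_m\times\mathbb{U}_n$ (every subgroup has this form). Action. $\mathbb{U}_m\times\mathbb{U}_n$ acts on $R$ by $K$-algebra automorphisms with $(\alpha^p,\beta^q)\cdot X=\alpha^pX$ and $(\alpha^p,\beta^q)\cdot Y=\beta^qY$. Put $A_{i,j,t,x}=R^{H_{i,j,t,x}}$ (ring of invariants) and $\mathfrak{n}=\mathfrak{m}\cap A_{i,j,t,x}$. An element $f\in R$ is an eigenfunction for $H_{i,j,t,x}$ if for every $g\in H_{i,j,t,x}$ there is $\lambda_g\in K$ with $g\cdot f=\lambda_g f$. Valuations. $\nu$ is a valuation of $K(X,Y)$ with value group $\Phi_\nu$; it dominates a local ring if its valuation ring contains that ring and the maximal ideal of the valuation ring contracts to the maximal ideal of the ring. Rational rank $1$ means $\Phi_\nu\otimes\mathbb{Q}\cong\mathbb{Q}$ (so $\Phi_\nu$ is regarded as an ordered subgroup of $\mathbb{Q}$), and non discrete means $\Phi_\nu\not\cong\mathbb{Z}$.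 For a local domain $B\subset K(X,Y)$ dominated by $\nu$, $S^{B}(\nu)=\{\nu(f): 0\ne f\in B\}$. The generating sequence of $\nu$ is the sequence $(Q_l)_{l\ge0}$ in $R$ produced by the algorithm of Cutkosky and Vinh: $Q_0=X$, $Q_1=Y$, $\gamma_l=\nu(Q_l)$; for $l\ge1$, $\overline{m_l}=\min\{q\in\mathbb{Z}_{>0}: q\gamma_l\in \sum_{k=0}^{l-1}\gamma_k\mathbb{Z}\}$, and $Q_{l+1}=Q_l^{\overline{m_l}}-\lambda_l X^{c_0}Y^{c_1}Q_2^{c_2}\cdots Q_{l-1}^{c_{l-1}}$, where $\overline{m_l}\gamma_l=\sum_{k=0}^{l-1}c_k\gamma_k$ is the unique representation with $c_0\in\mathbb{N}$ and $0\le c_k<\overline{m_k}$ for $1\le k\le l-1$, and $\lambda_l\in K\setminus\{0\}$ is the unique element such that $\nu(Q_{l+1})>\overline{m_l}\gamma_l$. It has the following properties: (1) $\gamma_{l+1}>\overline{m_l}\gamma_l$ for $l\ge1$; (2) $Q_l$ ($l\ge1$) is monic in $Y$ of degree $d(l)=\deg_Y Q_l$, with $d(1)=1$ and $d(l)=\prod_{k=1}^{l-1}\overline{m_k}$ for $l\ge2$; (3) every $f\in R$ with $\deg_Y f=d$ has a unique expression $f=\sum_{e=0}^{d} f_e$, $f_e=(\sum_l b_{l,e}X^l)Q_1^{j_1(e)}\cdots Q_r^{j_r(e)}$ with $b_{l,e}\in K$, $0\le j_k(e)<\overline{m_k}$, $\deg_Y(Q_1^{j_1(e)}\cdots Q_r^{j_r(e)})=e$;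 the values of distinct nonzero $f_e$ are distinct, so $\nu(f)=\min_e\nu(f_e)$; (4) $S^{R_{\mathfrak{m}}}(\nu)=\sum_{l\ge0}\gamma_l\mathbb{N}$. Finite generation. A semigroup $S$ is finitely generated over a subsemigroup $T$ (is a finitely generated $T$-module) if there are finitely many $s_1,\dots,s_k\in S$ with $S=\{s_1,\dots,s_k\}+T$. *)

theory Defs
  imports
    "HOL-Computational_Algebra.Computational_Algebra"
    "HOL-Number_Theory.Cong"
begin

text \<open>
  The ring \<open>R = K[X,Y]\<close> is \<open>'k poly poly\<close>, read as \<open>K[X][Y]\<close>: the outer variable is \<open>Y\<close>, the
  coefficients are polynomials in \<open>X\<close>. Its fraction field \<open>K(X,Y)\<close> is \<open>'k poly poly fract\<close>.
\<close>

definition varX :: "'k::field poly poly" where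
  "varX = [:[:0, 1:]:]"

definition varY :: "'k::field poly poly" where
  "varY = [:0, 1:]"

definition max_ideal_XY :: "'k::field poly poly set" where
  "max_ideal_XY = {u * varX + v * varY | u v. True}"


subsection \<open>The groups and their action\<close>

definition primitive_root_of_unity :: "nat \<Rightarrow> 'k::field \<Rightarrow> bool" where
  "primitive_root_of_unity n z \<longleftrightarrow> n > 0 \<and> z ^ n = 1 \<and> (\<forall>k. 0 < k \<and> k < n \<longrightarrow> z ^ k \<noteq> 1)"

definition admissible :: "nat \<Rightarrow> nat \<Rightarrow> nat \<Rightarrow> nat \<Rightarrow> nat \<Rightarrow> nat \<Rightarrow> bool" where
  "admissible m n i j t x \<longleftrightarrow>
     i > 0 \<and> j > 0 \<and> t > 0 \<and> i dvd m \<and> j dvd n \<and> t dvd m div i \<and> t dvd n div j \<and>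
     coprime x t \<and> 1 \<le> x \<and> x \<le> t"

definition H_group :: "'k::field \<Rightarrow> 'k \<Rightarrow> nat \<Rightarrow> nat \<Rightarrow> nat \<Rightarrow> nat \<Rightarrow> ('k \<times> 'k) set" where
  "H_group \<alpha> \<beta> i j t x =
     {(\<alpha> powi (a * int i), \<beta> powi (b * int j)) | a b :: int. [b = a * int x] (mod int t)}"

text \<open>The action of \<open>(p, q)\<close> sends \<open>f(X,Y)\<close> to \<open>f(pX,qY)\<close>.\<close>

definition act :: "'k::field \<times> 'k \<Rightarrow> 'k poly poly \<Rightarrow> 'k poly poly" where
  "act g f = pcompose (map_poly (\<lambda>c. pcompose c [:0, fst g:]) f) [:0, [:snd g:]:]"

lemma act_varX: "act (p, q) varX = smult [:p:] varX"
  by (simp add: act_def varX_def map_poly_pCons pcompose_pCons)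

lemma act_varY: "act (p, q) varY = smult [:q:] varY"
  by (simp add: act_def varY_def map_poly_pCons pcompose_pCons pcompose_1)

lemma act_const: "act g [:[:c:]:] = [:[:c:]:]"
  by (simp add: act_def map_poly_pCons pcompose_pCons)

definition invariants :: "('k::field \<times> 'k) set \<Rightarrow> 'k poly poly set" where
  "invariants H = {f. \<forall>g\<in>H. act g f = f}"

definition eigenfunction :: "('k::field \<times> 'k) set \<Rightarrow> 'k poly poly \<Rightarrow> bool" where
  "eigenfunction H f \<longleftrightarrow> (\<forall>g\<in>H. \<exists>c. act g f = smult [:c:] f)"


subsection \<open>Localizations inside the fraction field\<close>

text \<open>For a subring \<open>B\<close> and a prime ideal \<open>P\<close> of \<open>B\<close>: the local ring \<open>B\<^sub>P\<close> and its maximal ideal \<open>PB\<^sub>P\<close>.\<close>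

definition localization :: "'r::idom set \<Rightarrow> 'r set \<Rightarrow> 'r fract set" where
  "localization B P = {Fract f g | f g. f \<in> B \<and> g \<in> B \<and> g \<notin> P}"

definition localization_max :: "'r::idom set \<Rightarrow> 'r set \<Rightarrow> 'r fract set" where
  "localization_max B P = {Fract f g | f g. f \<in> P \<and> g \<in> B \<and> g \<notin> P}"

definition R_loc :: "'k::field poly poly fract set" where
  "R_loc = localization UNIV max_ideal_XY"

definition R_loc_max :: "'k::field poly poly fract set" where
  "R_loc_max = localization_max UNIV max_ideal_XY"

definition A_loc :: "('k::field \<times> 'k) set \<Rightarrow> 'k poly poly fract set" where
  "A_loc H = localization (invariants H) (max_ideal_XY \<inter> invariants H)"


subsection \<open>Valuations of rational rank one\<close>

text \<open>
  The value group of a valuation of rational rank one embeds into the rationals as an ordered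
  group, so valuations are taken with values in \<open>rat\<close>. A valuation is only meaningful on nonzero
  elements: its value at \<open>0\<close> (conventionally infinite) is arbitrary and never used.
\<close>

definition valuation :: "('f::field \<Rightarrow> rat) \<Rightarrow> bool" where
  "valuation \<nu> \<longleftrightarrow>
     (\<forall>f g. f \<noteq> 0 \<longrightarrow> g \<noteq> 0 \<longrightarrow> \<nu> (f * g) = \<nu> f + \<nu> g) \<and>
     (\<forall>f g. f \<noteq> 0 \<longrightarrow> g \<noteq> 0 \<longrightarrow> f + g \<noteq> 0 \<longrightarrow> \<nu> (f + g) \<ge> min (\<nu> f) (\<nu> g))"

definition value_group :: "('f::field \<Rightarrow> rat) \<Rightarrow> rat set" where
  "value_group \<nu> = \<nu> ` (UNIV - {0})"

definition valuation_ring :: "('f::field \<Rightarrow> rat) \<Rightarrow> 'f set" where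
  "valuation_ring \<nu> = {f. f = 0 \<or> \<nu> f \<ge> 0}"

definition valuation_ideal :: "('f::field \<Rightarrow> rat) \<Rightarrow> 'f set" where
  "valuation_ideal \<nu> = {f. f = 0 \<or> \<nu> f > 0}"

definition dominates :: "('f::field \<Rightarrow> rat) \<Rightarrow> 'f set \<Rightarrow> 'f set \<Rightarrow> bool" where
  "dominates \<nu> B M \<longleftrightarrow> B \<subseteq> valuation_ring \<nu> \<and> valuation_ideal \<nu> \<inter> B = M"

text \<open>
  For a subgroup \<open>\<Phi>\<close> of the rationals, \<open>\<Phi> \<otimes> \<rat>\<close> is identified (by flatness) with the rational span
  of \<open>\<Phi>\<close>, so the rational rank is the dimension of that span.
\<close>

definition rational_rank :: "rat set \<Rightarrow> nat" where
  "rational_rank \<Phi> = vector_space.dim ((*) :: rat \<Rightarrow> rat \<Rightarrow> rat) \<Phi>"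

definition isomorphic_to_int :: "rat set \<Rightarrow> bool" where
  "isomorphic_to_int \<Phi> \<longleftrightarrow>
     (\<exists>h :: int \<Rightarrow> rat. (\<forall>a b. h (a + b) = h a + h b) \<and> bij_betw h UNIV \<Phi>)"

definition rank1_nondiscrete_dominating :: "('k::field poly poly fract \<Rightarrow> rat) \<Rightarrow> bool" where
  "rank1_nondiscrete_dominating \<nu> \<longleftrightarrow>
     valuation \<nu> \<and> rational_rank (value_group \<nu>) = 1 \<and> \<not> isomorphic_to_int (value_group \<nu>) \<and>
     dominates \<nu> R_loc R_loc_max"

definition value_semigroup :: "'f::field set \<Rightarrow> ('f \<Rightarrow> rat) \<Rightarrow> rat set" where
  "value_semigroup B \<nu> = {\<nu> f | f. f \<in> B \<and> f \<noteq> 0}"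

definition finitely_generated_over :: "rat set \<Rightarrow> rat set \<Rightarrow> bool" where
  "finitely_generated_over S T \<longleftrightarrow>
     (\<exists>F. finite F \<and> F \<subseteq> S \<and> S = {s + u | s u. s \<in> F \<and> u \<in> T})"


subsection \<open>Generating sequences\<close>

definition gs_value ::
    "('k::field poly poly fract \<Rightarrow> rat) \<Rightarrow> (nat \<Rightarrow> 'k poly poly) \<Rightarrow> nat \<Rightarrow> rat" where
  "gs_value \<nu> Q l = \<nu> (to_fract (Q l))"

text \<open>The number \<open>m\<^sub>l\<close> with a bar, for \<open>l \<ge> 1\<close>.\<close>

definition gs_mbar ::
    "('k::field poly poly fract \<Rightarrow> rat) \<Rightarrow> (nat \<Rightarrow> 'k poly poly) \<Rightarrow> nat \<Rightarrow> nat" where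
  "gs_mbar \<nu> Q l =
     (LEAST q. q > 0 \<and>
        (\<exists>z :: nat \<Rightarrow> int. of_nat q * gs_value \<nu> Q l = (\<Sum>k<l. of_int (z k) * gs_value \<nu> Q k)))"

text \<open>
  The algorithm of Cutkosky and Vinh. Since \<open>c\<close> and \<open>\<mu>\<close> below are unique, the conditions determine
  \<open>Q\<close> from \<open>\<nu>\<close>, so the relation expresses that \<open>Q\<close> is the generating sequence of \<open>\<nu>\<close>.
\<close>

definition generating_sequence ::
    "('k::field poly poly fract \<Rightarrow> rat) \<Rightarrow> (nat \<Rightarrow> 'k poly poly) \<Rightarrow> bool" where
  "generating_sequence \<nu> Q \<longleftrightarrow>
     Q 0 = varX \<and> Q 1 = varY \<and>
     (\<forall>l\<ge>1. \<exists>(c :: nat \<Rightarrow> nat) \<mu>.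
        (\<forall>k. 1 \<le> k \<and> k < l \<longrightarrow> c k < gs_mbar \<nu> Q k) \<and>
        of_nat (gs_mbar \<nu> Q l) * gs_value \<nu> Q l = (\<Sum>k<l. of_nat (c k) * gs_value \<nu> Q k) \<and>
        \<mu> \<noteq> 0 \<and>
        Q (Suc l) = Q l ^ gs_mbar \<nu> Q l - smult [:\<mu>:] (\<Prod>k<l. Q k ^ c k) \<and>
        gs_value \<nu> Q (Suc l) > of_nat (gs_mbar \<nu> Q l) * gs_value \<nu> Q l)"

end

theory Submission
  imports Defs
begin

text \<open>
  If every \<open>Q l\<close> is an eigenfunction, then evaluating the relation \<open>mb 1 * \<gamma> 1 = a * \<gamma> 0\<close> (where
  \<open>a\<close> and \<open>mb 1\<close> are coprime) on \<open>(1, \<beta>^(jt))\<close> and \<open>(\<alpha>^(it), 1)\<close> shows that \<open>n/j\<close> divides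
  \<open>t * mb 1\<close> and \<open>m/i\<close> divides \<open>t * a\<close>, so \<open>gcd (m/i) (n/j)\<close> divides \<open>t\<close>. Conversely, suitable
  exponents \<open>c 0 = a\<close> and \<open>q 0 = mb 1\<close> can be continued to \<open>Q (l+2) = Q (l+1) ^ q l - X ^ c l\<close> with
  pairwise coprime \<open>q l\<close>; the corresponding valuation is the order of vanishing along the
  infinitely nested radical \<open>Y = (X^c 0 + (X^c 1 + \<dots>)^(1/q 1))^(1/q 0)\<close>, which stabilises on each
  polynomial at a finite depth.

  If \<open>t = 1\<close>, all \<open>Q l\<close> with \<open>l \<ge> 2\<close> are invariant, so only bounded powers of \<open>X\<close> and \<open>Y\<close> are needed
  as module generators. If a prime \<open>r\<close> divides \<open>t\<close>, then the character by which a group element acts on a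
  monomial in the \<open>Q l\<close> depends only on its value. This forces \<open>r\<close> not to divide \<open>mb l\<close> for
  \<open>l \<ge> 2\<close>, so that no \<open>Q l\<close> has trivial character and \<open>\<gamma> l\<close> is not a value of an invariant.
  As \<open>\<gamma> l\<close> is indecomposable in the semigroup for the infinitely many \<open>l\<close> with \<open>mb l > 1\<close>, all these
  \<open>\<gamma> l\<close> would have to be among the finitely many generators.
\<close>

subsection \<open>Ring morphisms and the group action\<close>

text \<open>The group action and the substitution of power series are both composites of
  coefficientwise maps, polynomial composition and evaluation, so their preservation laws follow
  from those of the building blocks.\<close>

locale comm_ring_morphism =
  fixes h :: "'a::comm_ring_1 \<Rightarrow> 'b::comm_ring_1"
  assumes hom_add: "h (x + y) = h x + h y"
    and hom_mult: "h (x * y) = h x * h y"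
    and hom_1: "h 1 = 1"
begin

lemma hom_0: "h 0 = 0"
  using hom_add[of 0 0] by simp

lemma hom_minus: "h (- x) = - h x"
  using hom_add[of x "- x"] by (simp add: hom_0 eq_neg_iff_add_eq_0 add.commute)

lemma hom_diff: "h (x - y) = h x - h y"
  using hom_add[of x "- y"] by (simp add: hom_minus)

lemma hom_power: "h (x ^ n) = h x ^ n"
  by (induction n) (simp_all add: hom_1 hom_mult)

lemma hom_sum: "h (sum f A) = (\<Sum>a\<in>A. h (f a))"
  by (induction A rule: infinite_finite_induct) (simp_all add: hom_0 hom_add)

lemma hom_prod: "h (prod f A) = (\<Prod>a\<in>A. h (f a))"
  by (induction A rule: infinite_finite_induct) (simp_all add: hom_1 hom_mult)

lemma map_poly_morphism: "comm_ring_morphism (map_poly h)"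
proof
  fix p q :: "'a poly"
  show "map_poly h (p + q) = map_poly h p + map_poly h q"
    by (rule poly_eqI) (simp add: coeff_map_poly hom_0 hom_add)
  show "map_poly h (p * q) = map_poly h p * map_poly h q"
    by (rule poly_eqI) (simp add: coeff_map_poly coeff_mult hom_0 hom_sum hom_mult)
  show "map_poly h 1 = 1"
    by (simp add: one_pCons map_poly_pCons hom_0 hom_1)
qed

end

lemma comm_ring_morphism_comp:
  assumes "comm_ring_morphism g" "comm_ring_morphism h"
  shows "comm_ring_morphism (\<lambda>x. g (h x))"
  using assms by (simp add: comm_ring_morphism_def)

lemma pcompose_morphism: "comm_ring_morphism (\<lambda>p. pcompose p q)"
  by unfold_locales (simp_all add: pcompose_add pcompose_mult pcompose_1)

lemma poly_morphism: "comm_ring_morphism (\<lambda>p. poly p y)"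
  by unfold_locales simp_all

lemma act_morphism: "comm_ring_morphism (act g)"
  unfolding act_def
  by (rule comm_ring_morphism_comp[OF pcompose_morphism
        comm_ring_morphism.map_poly_morphism[OF pcompose_morphism]])

lemma coeff_act:
  "coeff (act (p, q) f) k = smult (q ^ k) (pcompose (coeff f k) [:0, p:])"
proof -
  have "coeff (act (p, q) f) k = [:q:] ^ k * pcompose (coeff f k) [:0, p:]"
    by (simp add: act_def coeff_pcompose_linear coeff_map_poly)
  also have "[:q:] ^ k = [:q ^ k:]"
    by (induction k) (simp_all add: one_pCons)
  finally show ?thesis by simp
qed

lemma act_smult_const: "act g (smult [:c:] f) = smult [:c:] (act g f)"
  using comm_ring_morphism.hom_mult[OF act_morphism, of g "[:[:c:]:]" f] by (simp add: act_const)

text \<open>The action fixes the constant 1 and scales \<open>Y^degree f\<close> by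
  \<open>q ^ degree f\<close>; comparing top coefficients leaves no freedom for the
  eigenvalue.\<close>

lemma eigenvalue_monic:
  assumes "act (p, q) f = smult [:c:] f" "lead_coeff f = 1"
  shows "c = q ^ degree f"
proof -
  have "coeff (act (p, q) f) (degree f) = [:q ^ degree f:]"
    by (simp add: coeff_act assms(2) pcompose_1)
  with assms show ?thesis by simp
qed

lemma mem_max_ideal_XY_iff: "f \<in> max_ideal_XY \<longleftrightarrow> coeff (coeff f 0) 0 = (0::'k::field)"
proof
  assume "f \<in> max_ideal_XY"
  then show "coeff (coeff f 0) 0 = 0"
    by (auto simp: max_ideal_XY_def varX_def varY_def coeff_mult)
next
  assume 0: "coeff (coeff f 0) 0 = (0::'k)"
  obtain a g where f: "f = pCons a g" by (cases f)
  obtain b h where a: "a = pCons b h" by (cases a)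
  have "b = 0" using 0 by (simp add: f a)
  then have "f = [:h:] * varX + g * varY"
    by (simp add: f a varX_def varY_def)
  then show "f \<in> max_ideal_XY" unfolding max_ideal_XY_def by blast
qed

lemma poly_poly_module: "module (\<lambda>(c::'k::field) (f::'k poly poly). smult [:c:] f)"
proof
  fix a b :: 'k and x y :: "'k poly poly"
  show "smult [:a:] (x + y) = smult [:a:] x + smult [:a:] y" by (simp add: smult_add_right)
  have "[:a + b:] = [:a:] + [:b:]" by simp
  then show "smult [:a + b:] x = smult [:a:] x + smult [:b:] x" by (metis smult_add_left)
  show "smult [:a:] (smult [:b:] x) = smult [:a * b:] x" by (simp add: mult.commute)
  show "smult [:1:] x = x" by (metis one_pCons smult_1_left)
qed

section \<open>Division by monic polynomials and ultrametric sums\<close>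

lemma monic_division:
  fixes f g :: "'a::idom poly"
  assumes "lead_coeff g = 1" "degree g > 0"
  obtains q r where "f = q * g + r" "degree r < degree g"
    "degree f \<ge> degree g \<Longrightarrow> degree q + degree g = degree f" "degree f < degree g \<Longrightarrow> q = 0"
proof -
  have g: "g \<noteq> 0" using assms by auto
  obtain q r where qr: "pseudo_divmod f g = (q, r)" by force
  \<comment> \<open>Pseudo-division multiplies \<open>f\<close> by a power of the leading
    coefficient of \<open>g\<close>, which is 1 here.\<close>
  from pseudo_divmod[OF g qr] assms have 1: "f = q * g + r" "r = 0 \<or> degree r < degree g"
    by (auto simp: algebra_simps)
  then have 2: "degree r < degree g" using assms(2) by auto
  have 3: "degree f = degree q + degree g" if "q \<noteq> 0"
  proof -
    have "degree (q * g) = degree q + degree g" using that g by (rule degree_mult_eq)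
    then show ?thesis using 1 2 by (simp add: degree_add_eq_left)
  qed
  show ?thesis
  proof (rule that[OF 1(1) 2])
    show "degree q + degree g = degree f" if "degree f \<ge> degree g"
      using 3 1(1) 2 that by (cases "q = 0") simp_all
    show "q = 0" if "degree f < degree g"
      using 3 that by (cases "q = 0") simp_all
  qed
qed

text \<open>When all summands have different values, the least one is attained once and nothing can
  cancel it. Only nonzero arguments are constrained because the value of 0 is arbitrary.\<close>

lemma ultrametric_sum:
  fixes v :: "'a::ab_group_add \<Rightarrow> rat"
  assumes ultra: "\<And>x y. x \<noteq> 0 \<Longrightarrow> y \<noteq> 0 \<Longrightarrow> x + y \<noteq> 0 \<Longrightarrow> v (x + y) \<ge> min (v x) (v y)"
    and neg: "\<And>x. x \<noteq> 0 \<Longrightarrow> v (- x) = v x"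
    and E: "finite E" "E \<noteq> {}" "\<And>e. e \<in> E \<Longrightarrow> T e \<noteq> 0" "inj_on (\<lambda>e. v (T e)) E"
  shows "sum T E \<noteq> 0 \<and> v (sum T E) = Min ((\<lambda>e. v (T e)) ` E)"
proof -
  have two: "a + b \<noteq> 0 \<and> v (a + b) = min (v a) (v b)"
    if "a \<noteq> 0" "b \<noteq> 0" "v a < v b" for a b
  proof -
    have "a + b \<noteq> 0"
    proof
      assume "a + b = 0"
      then have "b = - a" by (simp add: eq_neg_iff_add_eq_0 add.commute)
      then show False using that neg by simp
    qed
    \<comment> \<open>Since \<open>a = (a + b) - b\<close> and \<open>v a < v b\<close>, this bounds
      \<open>v (a + b)\<close> from above.\<close>
    moreover have "v a \<ge> min (v (a + b)) (v b)"
      using ultra[of "a + b" "- b"] neg[of b] that calculation by simp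
    moreover have "v (a + b) \<ge> min (v a) (v b)" by (rule ultra[OF that(1,2) calculation(1)])
    ultimately show ?thesis using that by linarith
  qed
  have two': "a + b \<noteq> 0 \<and> v (a + b) = min (v a) (v b)"
    if "a \<noteq> 0" "b \<noteq> 0" "v a \<noteq> v b" for a b
    using two[of a b] two[of b a] that by (metis add.commute min.commute neqE)
  from E show ?thesis
  proof (induction E rule: finite_ne_induct)
    case (singleton x)
    then show ?case by simp
  next
    case (insert x F)
    then have IH: "sum T F \<noteq> 0" "v (sum T F) = Min ((\<lambda>e. v (T e)) ` F)"
      by (auto simp: inj_on_def)
    have "v (sum T F) \<in> (\<lambda>e. v (T e)) ` F"
      unfolding IH(2) by (rule Min_in) (use insert.hyps in auto)
    moreover have "v (T x) \<notin> (\<lambda>e. v (T e)) ` F"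
      using insert.prems(2) insert.hyps by (auto simp: inj_on_def)
    ultimately have "v (T x) \<noteq> v (sum T F)" by metis
    from two'[OF _ IH(1) this] insert.hyps insert.prems(1) show ?case by (simp add: IH)
  qed
qed

section \<open>Finitely generated subgroups of the rationals\<close>

lemma cyclic_rat_two:
  fixes g h :: rat
  obtains u a b c d where "u = of_int a * g + of_int b * h" "g = of_int c * u" "h = of_int d * u"
proof -
  obtain p q where pq: "quotient_of g = (p, q)" by force
  obtain r s where rs: "quotient_of h = (r, s)" by force
  have q: "q > 0" "g = of_int p / of_int q" using pq quotient_of_denom_pos quotient_of_div by blast+
  have s: "s > 0" "h = of_int r / of_int s" using rs quotient_of_denom_pos quotient_of_div by blast+
  define D where "D = q * s"
  define A where "A = p * s"
  define B where "B = r * q"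
  have D: "D > 0" "g = of_int A / of_int D" "h = of_int B / of_int D"
    using q s by (auto simp: D_def A_def B_def)
  obtain a b where ab: "a * A + b * B = gcd A B" using bezout_int by blast
  obtain c d where cd: "A = gcd A B * c" "B = gcd A B * d" by (meson dvdE gcd_dvd1 gcd_dvd2)
  \<comment> \<open>Over the common denominator \<open>D\<close>, Bezout for the numerators makes
    this a generator of the group spanned by \<open>g\<close> and \<open>h\<close>.\<close>
  let ?u = "of_int (gcd A B) / of_int D :: rat"
  show ?thesis
  proof (rule that[of ?u a b c d])
    have "of_int a * g + of_int b * h = of_int (a * A + b * B) / of_int D"
      by (simp add: D(2,3) add_divide_distrib)
    then show "?u = of_int a * g + of_int b * h" by (simp add: ab)
    have "of_int A = of_int c * (of_int (gcd A B) :: rat)"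
      by (subst (1) cd(1)) (simp only: of_int_mult mult.commute)
    then show "g = of_int c * ?u" by (simp only: D(2) times_divide_eq_right)
    have "of_int B = of_int d * (of_int (gcd A B) :: rat)"
      by (subst (1) cd(2)) (simp only: of_int_mult mult.commute)
    then show "h = of_int d * ?u" by (simp only: D(3) times_divide_eq_right)
  qed
qed

text \<open>Adjoining one value at a time keeps the group cyclic. Both directions are recorded:
  \<open>z\<close> writes the generator through the values, \<open>e\<close> writes the values
  through the generator.\<close>

lemma cyclic_rat:
  fixes \<gamma> :: "nat \<Rightarrow> rat"
  shows "\<exists>u z e. u = (\<Sum>k<l. of_int (z k) * \<gamma> k) \<and> (\<forall>k<l. \<gamma> k = of_int (e k) * u)"
proof (induction l)
  case 0
  show ?case by simp
next
  case (Suc l)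
  obtain u z e where u: "u = (\<Sum>k<l. of_int (z k) * \<gamma> k)" "\<And>k. k < l \<Longrightarrow> \<gamma> k = of_int (e k) * u"
    using Suc.IH by blast
  obtain w a b c d where w: "w = of_int a * u + of_int b * \<gamma> l" "u = of_int c * w" "\<gamma> l = of_int d * w"
    by (rule cyclic_rat_two)
  show ?case
  proof (intro exI conjI allI impI)
    show "w = (\<Sum>k<Suc l. of_int (if k < l then a * z k else b) * \<gamma> k)"
      by (simp add: w(1) u(1) sum_distrib_left mult.assoc)
    show "\<gamma> k = of_int (if k < l then e k * c else d) * w" if "k < Suc l" for k
    proof (cases "k < l")
      case True
      then show ?thesis using u(2)[OF True] w(2) by (simp add: mult.assoc)
    next
      case False
      then have "k = l" using that by simp
      then show ?thesis using w(3) by simp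
    qed
  qed
qed

section \<open>Primitive roots of unity and their powers\<close>

lemma primitive_root_power_eq_1_iff:
  assumes "primitive_root_of_unity n z"
  shows "z ^ k = 1 \<longleftrightarrow> n dvd k"
proof
  assume 1: "z ^ k = 1"
  have "z ^ k = (z ^ n) ^ (k div n) * z ^ (k mod n)"
    by (simp flip: power_mult power_add)
  moreover have zn: "z ^ n = 1" "n > 0" and min: "\<And>k. 0 < k \<Longrightarrow> k < n \<Longrightarrow> z ^ k \<noteq> 1"
    using assms by (auto simp: primitive_root_of_unity_def)
  ultimately have "z ^ (k mod n) = 1" using 1 by simp
  moreover have "k mod n < n" using zn by simp
  ultimately have "k mod n = 0" using min by (meson gr0I)
  then show "n dvd k" by (rule dvd_eq_mod_eq_0[THEN iffD2])
next
  assume "n dvd k"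
  then obtain q where "k = n * q" ..
  then show "z ^ k = 1" using assms by (simp add: power_mult primitive_root_of_unity_def)
qed

lemma primitive_root_nonzero: "primitive_root_of_unity n z \<Longrightarrow> z \<noteq> 0"
  by (auto simp: primitive_root_of_unity_def power_0_left)

lemma primitive_root_powi_eq_1_iff:
  assumes "primitive_root_of_unity n z"
  shows "z powi k = 1 \<longleftrightarrow> int n dvd k"
proof (cases "k \<ge> 0")
  case True
  then have "k = int (nat k)" by simp
  then show ?thesis using primitive_root_power_eq_1_iff[OF assms, of "nat k"]
    by (metis int_dvd_int_iff power_int_of_nat)
next
  case False
  then have k: "k = - int (nat (- k))" by simp
  have "z powi k = 1 \<longleftrightarrow> z ^ nat (- k) = 1"
    using primitive_root_nonzero[OF assms] False by (simp add: power_int_def power_inverse)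
  also have "\<dots> \<longleftrightarrow> int n dvd k"
    using primitive_root_power_eq_1_iff[OF assms, of "nat (- k)"] False
    by (metis k dvd_minus_iff int_dvd_int_iff)
  finally show ?thesis .
qed

lemma primitive_root_power:
  assumes "primitive_root_of_unity n z" "i dvd n" "i > 0"
  shows "primitive_root_of_unity (n div i) (z ^ i)"
proof -
  have n: "n > 0" using assms(1) by (simp add: primitive_root_of_unity_def)
  obtain q where q: "n = i * q" using assms(2) ..
  have "(z ^ i) ^ k = 1 \<longleftrightarrow> q dvd k" for k
    using primitive_root_power_eq_1_iff[OF assms(1), of "i * k"] assms(3)
    by (simp add: q flip: power_mult)
  moreover have "q > 0" using n by (simp add: q)
  ultimately show ?thesis using assms(3)
    by (simp add: primitive_root_of_unity_def q nat_dvd_not_less)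
qed

subsection \<open>Sequences of key polynomials\<close>

lemmas span_poly_poly_explicit = module.span_explicit[OF poly_poly_module]
lemmas span_poly_poly_base = module.span_base[OF poly_poly_module]
lemmas span_poly_poly_zero = module.span_zero[OF poly_poly_module]
lemmas span_poly_poly_add = module.span_add[OF poly_poly_module]
lemmas span_poly_poly_scale = module.span_scale[OF poly_poly_module]
lemmas span_poly_poly_sum = module.span_sum[OF poly_poly_module]
lemmas span_poly_poly_mono = module.span_mono[OF poly_poly_module]

abbreviation poly_poly_span :: "'k::field poly poly set \<Rightarrow> 'k poly poly set" where
  "poly_poly_span \<equiv> module.span (\<lambda>c. smult [:c:])"

lemma span_poly_poly_times:
  assumes "f \<in> poly_poly_span A" "\<And>a. a \<in> A \<Longrightarrow> a * g \<in> B"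
  shows "f * g \<in> poly_poly_span B"
proof -
  obtain t r where t: "t \<subseteq> A" "f = (\<Sum>a\<in>t. smult [:r a:] a)"
    using assms(1) unfolding span_poly_poly_explicit by blast
  have "f * g = (\<Sum>a\<in>t. smult [:r a:] (a * g))"
    by (simp add: t(2) sum_distrib_right)
  also have "\<dots> \<in> poly_poly_span B"
    using t(1) assms(2) by (intro span_poly_poly_sum span_poly_poly_scale span_poly_poly_base) auto
  finally show ?thesis .
qed

lemma const_poly_morphism: "comm_ring_morphism (\<lambda>a. [:a:])"
  by unfold_locales (simp_all add: one_pCons)

text \<open>The combinatorial content of a generating sequence, with values as bare rational
  numbers. No valuation occurs, so the results apply both to the sequence of a given valuation and
  to a constructed one whose valuation is yet to be built.\<close>

locale key_sequence =
  fixes Q :: "nat \<Rightarrow> 'k::field poly poly" and mb :: "nat \<Rightarrow> nat" and \<gamma> :: "nat \<Rightarrow> rat"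
  assumes Q_0: "Q 0 = varX" and Q_1: "Q (Suc 0) = varY"
    and mb_pos: "l \<ge> 1 \<Longrightarrow> mb l > 0"
    and mb_least: "l \<ge> 1 \<Longrightarrow> q > 0 \<Longrightarrow> of_nat q * \<gamma> l = (\<Sum>k<l. of_int (z k) * \<gamma> k) \<Longrightarrow> mb l \<le> q"
    and step: "l \<ge> 1 \<Longrightarrow> \<exists>c \<mu>. (\<forall>k. 1 \<le> k \<and> k < l \<longrightarrow> c k < mb k) \<and>
        of_nat (mb l) * \<gamma> l = (\<Sum>k<l. of_nat (c k) * \<gamma> k) \<and> \<mu> \<noteq> 0 \<and>
        Q (Suc l) = Q l ^ mb l - smult [:\<mu>:] (\<Prod>k<l. Q k ^ c k) \<and>
        \<gamma> (Suc l) > of_nat (mb l) * \<gamma> l"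
    and \<gamma>_0: "\<gamma> 0 > 0" and \<gamma>_1: "\<gamma> (Suc 0) > 0"
begin

text \<open>For \<open>l \<ge> 1\<close> this is the degree of \<open>Q l\<close> in Y; the empty
  product gives \<open>d 0 = 1\<close>, although \<open>Q 0\<close> has degree 0.\<close>

definition d :: "nat \<Rightarrow> nat" where "d l = (\<Prod>k\<in>{1..<l}. mb k)"

text \<open>Reduced exponents: the power \<open>e 0\<close> of X is unrestricted, and entries from
  \<open>n\<close> on vanish so that distinct vectors differ at an index that \<open>val n\<close>
  sees.\<close>

definition exponents :: "nat \<Rightarrow> (nat \<Rightarrow> nat) set" where
  "exponents n = {e. (\<forall>k. 1 \<le> k \<and> k < n \<longrightarrow> e k < mb k) \<and> (\<forall>k\<ge>n. e k = 0)}"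

definition mon :: "nat \<Rightarrow> (nat \<Rightarrow> nat) \<Rightarrow> 'k poly poly" where
  "mon n e = (\<Prod>k<n. Q k ^ e k)"

definition val :: "nat \<Rightarrow> (nat \<Rightarrow> nat) \<Rightarrow> rat" where
  "val n e = (\<Sum>k<n. of_nat (e k) * \<gamma> k)"

lemma d_Suc: "l \<ge> 1 \<Longrightarrow> d (Suc l) = mb l * d l"
  by (simp add: d_def prod.atLeastLessThan_Suc mult.commute)

lemma d_1: "d (Suc 0) = 1"
  by (simp add: d_def)

lemma d_pos: "d l > 0"
  unfolding d_def by (intro prod_pos) (simp add: mb_pos)

lemma \<gamma>_pos: "\<gamma> l > 0"
proof (induction l)
  case (Suc l)
  show ?case
  proof (cases "l = 0")
    case False
    with step[of l] have "\<gamma> (Suc l) > of_nat (mb l) * \<gamma> l" by auto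
    moreover have "of_nat (mb l) * \<gamma> l \<ge> 0" using Suc by simp
    ultimately show ?thesis by linarith
  qed (simp add: \<gamma>_1)
qed (rule \<gamma>_0)

lemma \<gamma>_less: "1 \<le> k \<Longrightarrow> k < l \<Longrightarrow> \<gamma> k < \<gamma> l"
proof (induction l)
  case (Suc l)
  then have "\<gamma> k \<le> \<gamma> l" by (cases "k = l") auto
  also have "\<gamma> l \<le> of_nat (mb l) * \<gamma> l" using mb_pos[of l] \<gamma>_pos[of l] Suc.prems by simp
  also have "\<dots> < \<gamma> (Suc l)" using step[of l] Suc.prems by auto
  finally show ?case .
qed simp

text \<open>The \<open>d k\<close> are the place values of the mixed radix system with bases
  \<open>mb k\<close>. In terms of degrees, a reduced monomial in the \<open>Q k\<close> with
  \<open>k < l\<close> stays below the degree of \<open>Q l\<close>.\<close>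

lemma mixed_radix_less: "l \<ge> 1 \<Longrightarrow> (\<And>k. 1 \<le> k \<Longrightarrow> k < l \<Longrightarrow> e k < mb k) \<Longrightarrow> (\<Sum>k\<in>{1..<l}. e k * d k) < d l"
proof (induction l rule: nat_induct_at_least)
  case base
  then show ?case by (simp add: d_1)
next
  case (Suc l)
  then have "(\<Sum>k\<in>{1..<Suc l}. e k * d k) < d l + e l * d l" by simp
  also have "\<dots> = Suc (e l) * d l" by simp
  also have "\<dots> \<le> mb l * d l" using Suc by (intro mult_le_mono1) (simp add: Suc_leI)
  finally show ?case using Suc d_Suc by simp
qed

lemma degree_Q_0: "degree (Q 0) = 0"
  by (simp add: Q_0 varX_def)

text \<open>The monomial subtracted from \<open>Q l ^ mb l\<close> is reduced, so its degree lies
  below \<open>d l\<close> and the leading term of the power survives.\<close>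

lemma monic_degree: "l \<ge> 1 \<Longrightarrow> lead_coeff (Q l) = 1 \<and> degree (Q l) = d l"
proof (induction l rule: less_induct)
  case (less l)
  show ?case
  proof (cases "l = 1")
    case True
    then show ?thesis by (simp add: Q_1 varY_def d_1)
  next
    case False
    then obtain l' where l: "l = Suc l'" "l' \<ge> 1" using less.prems by (cases l) auto
    obtain c \<mu> where c: "\<forall>k. 1 \<le> k \<and> k < l' \<longrightarrow> c k < mb k"
      "Q l = Q l' ^ mb l' - smult [:\<mu>:] (\<Prod>k<l'. Q k ^ c k)"
      using step[OF l(2)] l(1) by blast
    let ?P = "smult [:\<mu>:] (\<Prod>k<l'. Q k ^ c k)"
    have "lead_coeff (Q l') = 1 \<and> degree (Q l') = d l'" by (rule less.IH) (use l in auto)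
    then have IH: "lead_coeff (Q l') = 1" "degree (Q l') = d l'" by blast+
    then have "Q l' \<noteq> 0" by auto
    then have deg: "degree (Q l' ^ mb l') = d l" using IH l by (simp add: degree_power_eq d_Suc)
    have "degree ?P \<le> degree (\<Prod>k<l'. Q k ^ c k)" by (rule degree_smult_le)
    also have "\<dots> \<le> (\<Sum>k<l'. degree (Q k ^ c k))"
      using degree_prod_sum_le[of "{..<l'}" "\<lambda>k. Q k ^ c k"] by simp
    also have "\<dots> \<le> (\<Sum>k<l'. degree (Q k) * c k)"
      by (intro sum_mono degree_power_le)
    also have "\<dots> = (\<Sum>k\<in>{1..<l'}. degree (Q k) * c k)"
      by (rule sum.mono_neutral_right) (auto simp: degree_Q_0 not_less_eq_eq)
    also have "\<dots> = (\<Sum>k\<in>{1..<l'}. c k * d k)"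
      using less.IH l by (intro sum.cong) auto
    also have "\<dots> < d l'" using mixed_radix_less[OF l(2)] c(1) by simp
    also have "\<dots> \<le> d l" using mb_pos[of l'] l d_Suc[of l'] by simp
    finally have "degree ?P < degree (Q l' ^ mb l')" using deg by simp
    then have P: "degree ?P < d l" using deg by simp
    have "coeff (Q l' ^ mb l') (degree (Q l' ^ mb l')) = 1"
      by (simp only: lead_coeff_power IH(1) power_one)
    then have "coeff (Q l) (d l) = 1"
      unfolding c(2) coeff_diff coeff_eq_0[OF P] deg by simp
    moreover have "degree (Q l) = d l"
    proof -
      have "degree (- ?P + Q l' ^ mb l') = degree (Q l' ^ mb l')"
        by (rule degree_add_eq_right) (use P deg in simp)
      then show ?thesis unfolding c(2) deg by simp
    qed
    ultimately show ?thesis by simp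
  qed
qed

lemma Q_nonzero: "Q l \<noteq> 0"
proof (cases "l = 0")
  case True
  then show ?thesis by (simp add: Q_0 varX_def)
next
  case False
  then show ?thesis using monic_degree[of l] by auto
qed

lemma mon_nonzero: "mon n e \<noteq> 0"
  by (simp add: mon_def Q_nonzero)

text \<open>The multipliers \<open>a\<close> that admit such a relation form an ideal of the
  integers. A nonzero remainder of \<open>a\<close> modulo \<open>mb l\<close> would be a positive
  multiplier below the least one.\<close>

lemma mb_dvd:
  assumes l: "l \<ge> 1" and a: "of_int a * \<gamma> l = (\<Sum>k<l. of_int (z k) * \<gamma> k)"
  shows "int (mb l) dvd a"
proof (rule ccontr)
  assume "\<not> int (mb l) dvd a"
  define r where "r = a mod int (mb l)"
  define s where "s = a div int (mb l)"
  have "r \<ge> 0" "r \<noteq> 0" and r_less: "r < int (mb l)"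
    using \<open>\<not> int (mb l) dvd a\<close> mb_pos[OF l] by (simp_all add: r_def dvd_eq_mod_eq_0)
  then have r: "r > 0" "r < int (mb l)" by simp_all
  have as: "a = s * int (mb l) + r" by (simp add: r_def s_def)
  obtain c where c: "of_nat (mb l) * \<gamma> l = (\<Sum>k<l. of_nat (c k) * \<gamma> k)"
    using step[OF l] by blast
  have "of_nat (nat r) * \<gamma> l = of_int a * \<gamma> l - of_int s * (of_nat (mb l) * \<gamma> l)"
    using r by (simp add: as algebra_simps of_nat_nat)
  also have "\<dots> = (\<Sum>k<l. of_int (z k - s * int (c k)) * \<gamma> k)"
    unfolding a c by (simp add: sum_distrib_left sum_subtractf algebra_simps)
  finally have "mb l \<le> nat r" by (rule mb_least[OF l, rotated]) (use r in simp)
  then show False using r by simp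
qed

text \<open>The top coefficient is divisible by \<open>mb n\<close> and smaller in absolute value,
  hence zero. Descending, what remains is a multiple of \<open>\<gamma> 0\<close>, which is
  positive.\<close>

lemma relation_reduced:
  assumes "(\<Sum>k<n. of_int (z k) * \<gamma> k) = 0" "\<And>k. 1 \<le> k \<Longrightarrow> k < n \<Longrightarrow> \<bar>z k\<bar> < int (mb k)" "k < n"
  shows "z k = 0"
  using assms
proof (induction n arbitrary: k)
  case (Suc n)
  have "z n = 0"
  proof (cases "n = 0")
    case True
    then show ?thesis using Suc.prems(1) \<gamma>_0 by simp
  next
    case False
    have "of_int (z n) * \<gamma> n = (\<Sum>k<n. of_int (- z k) * \<gamma> k)"
      using Suc.prems(1) by (simp add: sum_negf eq_neg_iff_add_eq_0 add.commute)
    from mb_dvd[OF _ this] have "int (mb n) dvd z n" using False by simp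
    then show ?thesis using Suc.prems(2)[of n] False zdvd_imp_le[of "int (mb n)" "\<bar>z n\<bar>"] by auto
  qed
  then show ?case using Suc by (cases "k = n") auto
qed simp

lemma val_inj: "inj_on (val n) (exponents n)"
proof (rule inj_onI)
  fix e e' assume e: "e \<in> exponents n" "e' \<in> exponents n" "val n e = val n e'"
  have "(\<Sum>k<n. of_int (int (e k) - int (e' k)) * \<gamma> k) = 0"
    using e(3) by (simp add: val_def sum_subtractf algebra_simps)
  moreover have "\<bar>int (e k) - int (e' k)\<bar> < int (mb k)" if "1 \<le> k" "k < n" for k
  proof -
    have "e k < mb k" "e' k < mb k" using e(1,2) that by (auto simp: exponents_def)
    then show ?thesis by linarith
  qed
  ultimately have "int (e k) - int (e' k) = 0" if "k < n" for k
    using relation_reduced[of "\<lambda>k. int (e k) - int (e' k)" n k] that by blast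
  moreover have "e k = e' k" if "k \<ge> n" for k
    using e(1,2) that by (auto simp: exponents_def)
  ultimately show "e = e'" by (metis eq_iff_diff_eq_0 ext linorder_not_less of_nat_eq_iff)
qed

text \<open>Expansion in base \<open>Q n\<close>: below degree
  \<open>d (Suc n) = mb n * d n\<close>, repeated division by \<open>Q n\<close> uses only powers
  below \<open>mb n\<close>, and the remainders are expanded by induction.\<close>

lemma mem_span_mon:
  assumes "n \<ge> 1" "degree f < d n"
  shows "f \<in> poly_poly_span (mon n ` exponents n)"
  using assms
proof (induction n arbitrary: f rule: nat_induct_at_least)
  case base
  then have "degree f = 0" by (simp add: d_1)
  then obtain g where g: "f = [:g:]" by (rule degree_eq_zeroE)
  have X: "(varX :: 'k poly poly) ^ i = [:monom 1 i:]" for i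
    using comm_ring_morphism.hom_power[OF const_poly_morphism, of "[:0, 1::'k:]" i]
    by (simp add: varX_def monom_altdef)
  have "f = [:\<Sum>i\<le>degree g. monom (coeff g i) i:]" by (simp add: g poly_as_sum_of_monoms)
  also have "\<dots> = (\<Sum>i\<le>degree g. [:monom (coeff g i) i:])"
    by (rule comm_ring_morphism.hom_sum[OF const_poly_morphism])
  also have "\<dots> = (\<Sum>i\<le>degree g. smult [:coeff g i:] (varX ^ i))"
    by (simp add: X smult_monom)
  also have "\<dots> \<in> poly_poly_span (mon 1 ` exponents 1)"
  proof (intro span_poly_poly_sum span_poly_poly_scale span_poly_poly_base)
    show "varX ^ i \<in> mon 1 ` exponents 1" for i
      by (rule image_eqI[of _ _ "\<lambda>k. if k = 0 then i else 0"]) (auto simp: mon_def Q_0 exponents_def)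
  qed
  finally show ?case .
next
  case (Suc n)
  note IH = Suc.IH
  \<comment> \<open>For \<open>j \<le> mb n\<close> the span of \<open>G j\<close> contains all
    polynomials of degree below \<open>j * d n\<close>; each division by \<open>Q n\<close> lowers
    \<open>j\<close> by one.\<close>
  define G where "G j = mon (Suc n) ` {e \<in> exponents (Suc n). e n < j}" for j
  have emb: "mon n ` exponents n \<subseteq> G (Suc j)" for j
  proof
    fix a assume "a \<in> mon n ` exponents n"
    then obtain e where e: "e \<in> exponents n" "a = mon n e" by blast
    then have "e n = 0" by (simp add: exponents_def)
    moreover have "e \<in> exponents (Suc n)"
      using e(1) mb_pos[of n] by (auto simp: exponents_def less_Suc_eq)
    moreover have "a = mon (Suc n) e" using e \<open>e n = 0\<close> by (simp add: mon_def)
    ultimately show "a \<in> G (Suc j)"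
      unfolding G_def by (intro image_eqI[of _ _ e]) (use \<open>e n = 0\<close> in auto)
  qed
  have times: "a * Q n \<in> G (Suc j)" if aj: "a \<in> G j" "Suc j \<le> mb n" for a j
  proof -
    obtain e where e: "e \<in> exponents (Suc n)" "e n < j" "a = mon (Suc n) e"
      using aj(1) by (auto simp: G_def)
    let ?e = "e(n := Suc (e n))"
    have "(\<Prod>k<n. Q k ^ ?e k) = (\<Prod>k<n. Q k ^ e k)" by (rule prod.cong) auto
    then have "a * Q n = mon (Suc n) ?e"
      by (simp add: e(3) mon_def mult_ac)
    moreover have "?e \<in> exponents (Suc n)" using e aj(2) by (auto simp: exponents_def)
    moreover have "?e n < Suc j" using e by simp
    ultimately show ?thesis unfolding G_def by (intro image_eqI[of _ _ ?e]) auto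
  qed
  have Qn: "lead_coeff (Q n) = 1" "degree (Q n) = d n" using monic_degree[OF Suc.hyps] by blast+
  have main: "f \<in> poly_poly_span (G j)" if "j \<le> mb n" "degree f < j * d n" for f j
    using that
  proof (induction j arbitrary: f)
    case 0
    then show ?case by simp
  next
    case (Suc j)
    have Qpos: "degree (Q n) > 0" using Qn(2) d_pos[of n] by simp
    obtain q r where qr: "f = q * Q n + r" "degree r < degree (Q n)"
      "degree f \<ge> degree (Q n) \<Longrightarrow> degree q + degree (Q n) = degree f" "degree f < degree (Q n) \<Longrightarrow> q = 0"
      using monic_division[OF Qn(1) Qpos] by metis
    have r: "r \<in> poly_poly_span (G (Suc j))"
      using IH[of r] qr(2) Qn span_poly_poly_mono[OF emb] by auto
    have "q * Q n \<in> poly_poly_span (G (Suc j))"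
    proof (cases "degree f < degree (Q n)")
      case True
      then show ?thesis using qr(4) span_poly_poly_zero by simp
    next
      case False
      then have "degree q < j * d n" using qr(3) Suc.prems Qn by simp
      then have "q \<in> poly_poly_span (G j)" using Suc by simp
      then show ?thesis using times Suc.prems by (intro span_poly_poly_times) auto
    qed
    then show ?case using qr(1) r span_poly_poly_add by simp
  qed
  have "f \<in> poly_poly_span (G (mb n))" using main Suc d_Suc by simp
  moreover have "G (mb n) \<subseteq> mon (Suc n) ` exponents (Suc n)" unfolding G_def by blast
  ultimately show ?case using span_poly_poly_mono by blast
qed

lemma expansion:
  assumes "n \<ge> 1" "degree f < d n" "f \<noteq> 0"
  shows "\<exists>E c. finite E \<and> E \<noteq> {} \<and> E \<subseteq> exponents n \<and> (\<forall>e\<in>E. c e \<noteq> 0) \<and>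
    f = (\<Sum>e\<in>E. smult [:c e:] (mon n e))"
proof -
  obtain t r where t: "finite t" "t \<subseteq> mon n ` exponents n" "f = (\<Sum>a\<in>t. smult [:r a:] a)"
    using mem_span_mon[OF assms(1,2)] unfolding span_poly_poly_explicit by blast
  define t' where "t' = {a \<in> t. r a \<noteq> 0}"
  have "f = (\<Sum>a\<in>t'. smult [:r a:] a)"
    unfolding t(3) t'_def using t(1) by (intro sum.mono_neutral_right) auto
  moreover have "t' \<subseteq> mon n ` exponents n" using t by (auto simp: t'_def)
  \<comment> \<open>One exponent vector is chosen for each monomial, so that the sum can be indexed
    by vectors.\<close>
  then obtain U where U: "U \<subseteq> exponents n" "inj_on (mon n) U" "t' = mon n ` U"
    by (auto simp: subset_image_inj)
  ultimately have f: "f = (\<Sum>e\<in>U. smult [:r (mon n e):] (mon n e))" by (simp add: sum.reindex)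
  have "finite t'" using t by (simp add: t'_def)
  then have "finite U" using U by (simp add: finite_image_iff)
  moreover have "U \<noteq> {}" using f assms(3) by auto
  moreover have "r (mon n e) \<noteq> 0" if "e \<in> U" for e using that U(3) by (auto simp: t'_def)
  ultimately show ?thesis
    by (intro exI[of _ U] exI[of _ "\<lambda>e. r (mon n e)"]) (use U(1) f in simp)
qed

end

subsection \<open>Weights of the key polynomials\<close>

locale key_sequence_eigen = key_sequence Q mb \<gamma>
  for Q :: "nat \<Rightarrow> 'k::field poly poly" and mb \<gamma> +
  fixes p q :: 'k
  assumes p_nonzero: "p \<noteq> 0" and q_nonzero: "q \<noteq> 0"
    and eigen: "\<exists>c. act (p, q) (Q l) = smult [:c:] (Q l)"
begin

text \<open>The eigenvalue of \<open>Q l\<close> under \<open>(p, q)\<close>. For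
  \<open>l \<ge> 1\<close> it is forced, since \<open>Q l\<close> is monic of degree
  \<open>d l\<close> in Y.\<close>

definition w :: "nat \<Rightarrow> 'k" where
  "w l = (if l = 0 then p else q ^ d l)"

lemma w_nonzero: "w l \<noteq> 0"
  by (simp add: w_def p_nonzero q_nonzero)

lemma act_Q: "act (p, q) (Q l) = smult [:w l:] (Q l)"
proof (cases "l = 0")
  case True
  then show ?thesis by (simp add: w_def Q_0 act_varX)
next
  case False
  obtain c where "act (p, q) (Q l) = smult [:c:] (Q l)" using eigen by blast
  moreover have "lead_coeff (Q l) = 1" "degree (Q l) = d l" using monic_degree[of l] False by auto
  ultimately show ?thesis using eigenvalue_monic[of p q "Q l" c] False by (simp add: w_def)
qed

lemma act_mon: "act (p, q) (mon n e) = smult [:\<Prod>k<n. w k ^ e k:] (mon n e)"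
proof -
  have "act (p, q) (mon n e) = (\<Prod>k<n. smult ([:w k:] ^ e k) (Q k ^ e k))"
    by (simp add: mon_def comm_ring_morphism.hom_prod[OF act_morphism]
        comm_ring_morphism.hom_power[OF act_morphism] act_Q smult_power)
  also have "\<dots> = smult (\<Prod>k<n. [:w k:] ^ e k) (mon n e)"
    by (simp add: mon_def prod_smult)
  also have "(\<Prod>k<n. [:w k:] ^ e k) = [:\<Prod>k<n. w k ^ e k:]"
    by (simp add: comm_ring_morphism.hom_prod[OF const_poly_morphism]
        comm_ring_morphism.hom_power[OF const_poly_morphism])
  finally show ?thesis .
qed

text \<open>\<open>Q (Suc l)\<close> and \<open>Q l ^ mb l\<close> are scaled by the same factor
  \<open>w l ^ mb l\<close>, so the subtracted monomial is scaled by it too, its coefficient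
  \<open>\<mu>\<close> being nonzero.\<close>

lemma w_step:
  assumes l: "l \<ge> 1"
  obtains c where "of_nat (mb l) * \<gamma> l = (\<Sum>k<l. of_nat (c k) * \<gamma> k)"
    "(\<Prod>k<l. w k ^ c k) = w l ^ mb l"
proof -
  obtain c \<mu> where c: "of_nat (mb l) * \<gamma> l = (\<Sum>k<l. of_nat (c k) * \<gamma> k)" "\<mu> \<noteq> 0"
    "Q (Suc l) = Q l ^ mb l - smult [:\<mu>:] (\<Prod>k<l. Q k ^ c k)"
    using step[OF l] by blast
  let ?P = "mon l c" and ?\<pi> = "\<Prod>k<l. w k ^ c k"
  have Q: "Q (Suc l) = Q l ^ mb l - smult [:\<mu>:] ?P" by (simp add: c(3) mon_def)
  have wS: "w (Suc l) = w l ^ mb l"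
    using l d_Suc[OF l] by (simp add: w_def mult.commute flip: power_mult)
  have "smult [:w l ^ mb l:] (Q (Suc l)) = act (p, q) (Q (Suc l))"
    by (simp add: act_Q wS)
  also have "\<dots> = act (p, q) (Q l) ^ mb l - smult [:\<mu>:] (act (p, q) ?P)"
    unfolding Q comm_ring_morphism.hom_diff[OF act_morphism] act_smult_const
      comm_ring_morphism.hom_power[OF act_morphism] ..
  also have "act (p, q) (Q l) ^ mb l = smult [:w l ^ mb l:] (Q l ^ mb l)"
    by (simp add: act_Q smult_power comm_ring_morphism.hom_power[OF const_poly_morphism])
  finally have "smult [:\<mu> * ?\<pi>:] ?P = smult [:\<mu> * w l ^ mb l:] ?P"
    by (simp add: Q act_mon smult_diff_right algebra_simps)
  then have "smult ([:\<mu> * ?\<pi>:] - [:\<mu> * w l ^ mb l:]) ?P = 0"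
    unfolding smult_diff_left by simp
  then have "\<mu> * ?\<pi> = \<mu> * w l ^ mb l" using mon_nonzero[of l c] by simp
  then show ?thesis using that c(1,2) by simp
qed

text \<open>The weight of a monomial in the key polynomials depends only on its value, because the
  relations among the values are generated by those that define the key polynomials.\<close>
lemma w_relation:
  "(\<Sum>k<n. of_int (z k) * \<gamma> k) = 0 \<Longrightarrow> (\<Prod>k<n. w k powi z k) = 1"
proof (induction n arbitrary: z)
  case (Suc n)
  show ?case
  proof (cases "n = 0")
    case True
    then show ?thesis using Suc.prems \<gamma>_0 by simp
  next
    case False
    then have n: "n \<ge> 1" by simp
    have "of_int (z n) * \<gamma> n = (\<Sum>k<n. of_int (- z k) * \<gamma> k)"
      using Suc.prems by (simp add: sum_negf eq_neg_iff_add_eq_0 add.commute)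
    from mb_dvd[OF n this] obtain s where s: "z n = int (mb n) * s" ..
    obtain c where c: "of_nat (mb n) * \<gamma> n = (\<Sum>k<n. of_nat (c k) * \<gamma> k)"
      "(\<Prod>k<n. w k ^ c k) = w n ^ mb n"
      by (rule w_step[OF n])
    \<comment> \<open>Index \<open>n\<close> is eliminated by replacing
      \<open>mb n * \<gamma> n\<close>, taken \<open>s\<close> times, through the relation that
      defines \<open>Q (Suc n)\<close>.\<close>
    have "(\<Sum>k<n. of_int (z k + int (c k) * s) * \<gamma> k) =
        (\<Sum>k<n. of_int (z k) * \<gamma> k) + of_int s * (\<Sum>k<n. of_nat (c k) * \<gamma> k)"
      by (simp add: sum_distrib_left sum.distrib algebra_simps)
    also have "\<dots> = 0" unfolding c(1)[symmetric] using Suc.prems by (simp add: s mult_ac)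
    finally have "(\<Prod>k<n. w k powi (z k + int (c k) * s)) = 1" by (rule Suc.IH)
    also have "(\<Prod>k<n. w k powi (z k + int (c k) * s)) =
        (\<Prod>k<n. w k powi z k) * (\<Prod>k<n. (w k ^ c k) powi s)"
      by (simp add: power_int_add w_nonzero prod.distrib power_int_power)
    also have "(\<Prod>k<n. (w k ^ c k) powi s) = w n powi z n"
    proof -
      have "(\<Prod>k<n. (w k ^ c k) powi s) = (\<Prod>k<n. w k ^ c k) powi s"
        by (induction n) (simp_all add: power_int_mult_distrib)
      then show ?thesis by (simp add: c(2) s power_int_power)
    qed
    finally show ?thesis by simp
  qed
qed simp

text \<open>The values \<open>\<gamma> k\<close> with \<open>k < l\<close> generate a cyclic group, and the weight of a generator has order
  divisible by \<open>r\<close>. Comparing weights in the relation defining \<open>Q (l+1)\<close>, \<open>r dvd mb l\<close> would make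
  \<open>mb l * \<gamma> l\<close> an \<open>r\<close>-fold multiple in that group, against the minimality of \<open>mb l\<close>.\<close>
lemma mb_coprime_order:
  assumes l: "l \<ge> 2" and r: "prime r" "r dvd M" and p: "primitive_root_of_unity M p"
  shows "\<not> r dvd mb l"
proof
  assume dvd: "r dvd mb l"
  obtain c where c: "of_nat (mb l) * \<gamma> l = (\<Sum>k<l. of_nat (c k) * \<gamma> k)"
    "(\<Prod>k<l. w k ^ c k) = w l ^ mb l"
    by (rule w_step[of l]) (use l in auto)
  obtain u z e where u: "u = (\<Sum>k<l. of_int (z k) * \<gamma> k)" and e: "\<forall>k<l. \<gamma> k = of_int (e k) * u"
    using cyclic_rat by blast
  \<comment> \<open>\<open>\<psi>\<close> is the weight belonging to the generator \<open>u\<close>.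
    Applying \<open>w_relation\<close> to \<open>e k * u - \<gamma> k = 0\<close> shows that every
    \<open>w k\<close> with \<open>k < l\<close> is a power of it.\<close>
  define \<psi> where "\<psi> = (\<Prod>k<l. w k powi z k)"
  have \<psi>_powi: "\<psi> powi a = (\<Prod>k<l. w k powi (z k * a))" for a
    unfolding \<psi>_def by (induction l) (simp_all add: power_int_mult_distrib power_int_mult)
  have \<psi>_nz: "\<psi> \<noteq> 0" by (simp add: \<psi>_def w_nonzero)
  have w\<psi>: "w k = \<psi> powi e k" if k: "k < l" for k
  proof -
    have "(\<Sum>i<l. of_int (z i * e k - (if i = k then 1 else 0)) * \<gamma> i) =
        of_int (e k) * u - (\<Sum>i<l. if i = k then \<gamma> i else 0)"
      unfolding u sum_distrib_left sum_subtractf[symmetric] by (intro sum.cong) (auto simp: algebra_simps)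
    also have "\<dots> = 0" using e k by simp
    finally have "1 = (\<Prod>i<l. w i powi (z i * e k - (if i = k then 1 else 0)))"
      using w_relation by metis
    also have "\<dots> = (\<Prod>i<l. w i powi (z i * e k) / (if i = k then w i else 1))"
      by (intro prod.cong) (auto simp: power_int_diff w_nonzero)
    also have "\<dots> = \<psi> powi e k / w k"
      using k by (simp add: prod_dividef \<psi>_powi)
    finally show ?thesis using w_nonzero[of k] by (simp add: field_simps)
  qed
  define s where "s = (\<Sum>k<l. int (c k) * e k)"
  have su: "of_nat (mb l) * \<gamma> l = of_int s * u"
    using e by (simp add: c(1) s_def sum_distrib_right mult.assoc)
  have "\<not> int r dvd s"
  proof
    assume "int r dvd s"
    then obtain s' where s': "s = int r * s'" ..
    obtain b where b: "mb l = r * b" using dvd ..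
    have mb: "mb l > 0" by (rule mb_pos) (use l in simp)
    then have b0: "b > 0" "r > 0" by (auto simp: b)
    have "of_nat b * \<gamma> l = of_int s' * u"
      using su b0 by (simp add: b s')
    also have "\<dots> = (\<Sum>k<l. of_int (s' * z k) * \<gamma> k)"
      by (simp add: u sum_distrib_left mult_ac)
    finally have "mb l \<le> b" by (rule mb_least[rotated 2]) (use l b0 in auto)
    then show False using b b0 prime_gt_1_nat[OF r(1)] by simp
  qed
  moreover have "int r dvd s"
  proof -
    \<comment> \<open>Both sides of the weight relation for \<open>Q (Suc l)\<close> are powers of
      \<open>\<psi>\<close>, and \<open>h\<close> is the difference of the exponents. As
      \<open>l \<ge> 2\<close>, both \<open>p\<close> and \<open>q\<close> are earlier weights;
      \<open>p\<close> being a power of \<open>\<psi>\<close>, its order \<open>M\<close> divides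
      \<open>h\<close>.\<close>
    define h where "h = s - int (mb l) * (e 1 * int (d l))"
    have "w l = w 1 ^ d l" using l by (simp add: w_def d_1)
    also have "\<dots> = \<psi> powi (e 1 * int (d l))"
      using w\<psi>[of 1] l by (simp add: power_int_power')
    finally have "w l ^ mb l = \<psi> powi (int (mb l) * (e 1 * int (d l)))"
      by (simp add: power_int_power' mult.commute)
    moreover have "(\<Prod>k<l. w k ^ c k) = \<psi> powi s"
    proof -
      have "(\<Prod>k<l. w k ^ c k) = (\<Prod>k<l. \<psi> powi (int (c k) * e k))"
        by (intro prod.cong) (simp_all add: w\<psi> power_int_power' mult.commute)
      also have "\<dots> = \<psi> powi s"
        unfolding s_def by (induction l) (simp_all add: power_int_add \<psi>_nz)
      finally show ?thesis .
    qed
    ultimately have "\<psi> powi h = 1"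
      using c(2) \<psi>_nz by (simp add: h_def power_int_diff)
    moreover have "p = \<psi> powi e 0" using w\<psi>[of 0] l by (simp add: w_def)
    then have "p powi h = (\<psi> powi h) powi e 0"
      by (simp add: mult.commute flip: power_int_mult)
    ultimately have "int M dvd h" using primitive_root_powi_eq_1_iff[OF p] by simp
    then have "int r dvd h" using r(2) by (meson dvd_trans int_dvd_int_iff)
    moreover have "int r dvd int (mb l) * (e 1 * int (d l))" using dvd by simp
    ultimately show ?thesis unfolding h_def by (simp add: dvd_diff_right_iff dvd_diff_left_iff)
  qed
  ultimately show False by blast
qed

end

subsection \<open>Values\<close>

lemma valuation_mult: "valuation \<nu> \<Longrightarrow> f \<noteq> 0 \<Longrightarrow> g \<noteq> 0 \<Longrightarrow> \<nu> (f * g) = \<nu> f + \<nu> g"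
  by (simp add: valuation_def)

lemma valuation_add: "valuation \<nu> \<Longrightarrow> f \<noteq> 0 \<Longrightarrow> g \<noteq> 0 \<Longrightarrow> f + g \<noteq> 0 \<Longrightarrow> \<nu> (f + g) \<ge> min (\<nu> f) (\<nu> g)"
  by (simp add: valuation_def)

lemma valuation_1: "valuation \<nu> \<Longrightarrow> \<nu> 1 = 0"
  using valuation_mult[of \<nu> 1 1] by simp

lemma valuation_uminus:
  assumes "valuation \<nu>" "f \<noteq> 0"
  shows "\<nu> (- f) = \<nu> f"
proof -
  have "\<nu> (-1) = 0" using valuation_mult[OF assms(1), of "-1" "-1"] valuation_1[OF assms(1)] by simp
  then show ?thesis using valuation_mult[OF assms(1), of "-1" f] assms(2) by simp
qed

lemma valuation_divide: "valuation \<nu> \<Longrightarrow> f \<noteq> 0 \<Longrightarrow> g \<noteq> 0 \<Longrightarrow> \<nu> (f / g) = \<nu> f - \<nu> g"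
  using valuation_mult[of \<nu> "f / g" g] by simp

lemma valuation_power: "valuation \<nu> \<Longrightarrow> f \<noteq> 0 \<Longrightarrow> \<nu> (f ^ n) = of_nat n * \<nu> f"
  by (induction n) (simp_all add: valuation_1 valuation_mult algebra_simps)

lemma valuation_powi:
  assumes "valuation \<nu>" "f \<noteq> 0"
  shows "\<nu> (f powi z) = of_int z * \<nu> f"
proof (cases "z \<ge> 0")
  case True
  then show ?thesis using assms by (simp add: power_int_def valuation_power)
next
  case False
  have "\<nu> (f powi z) = \<nu> (1 / f ^ nat (- z))"
    using False by (simp add: power_int_def divide_inverse power_inverse)
  also have "\<dots> = of_int z * \<nu> f"
    using False assms by (simp add: valuation_divide valuation_1 valuation_power)
  finally show ?thesis .
qed

lemma valuation_prod:
  assumes "valuation \<nu>" "\<And>a. a \<in> A \<Longrightarrow> f a \<noteq> 0"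
  shows "\<nu> (prod f A) = (\<Sum>a\<in>A. \<nu> (f a))"
  using assms(2)
proof (induction A rule: infinite_finite_induct)
  case (insert x A)
  then have "prod f A \<noteq> 0" by auto
  then show ?case using insert by (simp add: valuation_mult[OF assms(1)])
qed (simp_all add: valuation_1[OF assms(1)])

locale valued_key_sequence = key_sequence Q mb \<gamma>
  for Q :: "nat \<Rightarrow> 'k::field poly poly" and mb \<gamma> +
  fixes \<nu> :: "'k poly poly fract \<Rightarrow> rat"
  assumes valuation: "valuation \<nu>"
    and \<gamma>_eq: "\<gamma> l = \<nu> (to_fract (Q l))"
    and nonneg: "f \<noteq> 0 \<Longrightarrow> \<nu> (to_fract f) \<ge> 0"
begin

definition v :: "'k poly poly \<Rightarrow> rat" where "v f = \<nu> (to_fract f)"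

lemma v_mult: "f \<noteq> 0 \<Longrightarrow> g \<noteq> 0 \<Longrightarrow> v (f * g) = v f + v g"
  by (simp add: v_def valuation_mult[OF valuation])

lemma v_add: "f \<noteq> 0 \<Longrightarrow> g \<noteq> 0 \<Longrightarrow> f + g \<noteq> 0 \<Longrightarrow> v (f + g) \<ge> min (v f) (v g)"
  using valuation_add[OF valuation, of "to_fract f" "to_fract g"]
  by (simp add: v_def flip: to_fract_add)

lemma v_uminus: "f \<noteq> 0 \<Longrightarrow> v (- f) = v f"
  by (simp add: v_def valuation_uminus[OF valuation])

lemma v_nonneg: "f \<noteq> 0 \<Longrightarrow> v f \<ge> 0"
  by (simp add: v_def nonneg)

lemma v_1: "v 1 = 0"
  by (simp add: v_def valuation_1[OF valuation])

lemma v_Q: "v (Q l) = \<gamma> l"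
  by (simp add: v_def \<gamma>_eq)

lemma v_power: "f \<noteq> 0 \<Longrightarrow> v (f ^ n) = of_nat n * v f"
  by (induction n) (simp_all add: v_1 v_mult algebra_simps)

lemma v_mon: "v (mon n e) = val n e"
proof (induction n)
  case (Suc n)
  then show ?case using mon_nonzero[of n e]
    by (simp add: mon_def val_def v_mult v_power v_Q Q_nonzero)
qed (simp add: mon_def val_def v_1)

text \<open>A nonzero constant and its inverse both have nonnegative value, and the two values add
  up to 0.\<close>

lemma v_smult:
  assumes "c \<noteq> 0" "f \<noteq> 0"
  shows "v (smult [:c:] f) = v f"
proof -
  have "v [:[:c:]:] + v [:[:inverse c:]:] = v ([:[:c:]:] * [:[:inverse c:]:])"
    using assms(1) by (subst v_mult) auto
  also have "[:[:c:]:] * [:[:inverse c:]:] = (1 :: 'k poly poly)"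
    using assms(1) by (simp flip: one_pCons)
  finally have "v [:[:c:]:] = 0"
    using v_nonneg[of "[:[:c:]:]"] v_nonneg[of "[:[:inverse c:]:]"] assms(1) by (simp add: v_1)
  then show ?thesis using v_mult[of "[:[:c:]:]" f] assms by simp
qed

text \<open>Distinct reduced vectors have distinct values, so the least of them is the value of the
  sum. The nonvanishing half doubles as linear independence of reduced monomials.\<close>

lemma v_expansion:
  assumes "finite E" "E \<noteq> {}" "E \<subseteq> exponents n" "\<And>e. e \<in> E \<Longrightarrow> c e \<noteq> 0"
  shows "(\<Sum>e\<in>E. smult [:c e:] (mon n e)) \<noteq> 0 \<and>
    v (\<Sum>e\<in>E. smult [:c e:] (mon n e)) \<in> val n ` E"
proof -
  have eq: "v (smult [:c e:] (mon n e)) = val n e" if "e \<in> E" for e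
    using that assms(4) by (simp add: v_smult mon_nonzero v_mon)
  have "(\<Sum>e\<in>E. smult [:c e:] (mon n e)) \<noteq> 0 \<and>
      v (\<Sum>e\<in>E. smult [:c e:] (mon n e)) = Min ((\<lambda>e. v (smult [:c e:] (mon n e))) ` E)"
  proof (rule ultrametric_sum[OF v_add v_uminus assms(1,2)])
    show "smult [:c e:] (mon n e) \<noteq> 0" if "e \<in> E" for e
      using that assms(4) by (simp add: mon_nonzero)
    show "inj_on (\<lambda>e. v (smult [:c e:] (mon n e))) E"
      using inj_on_subset[OF val_inj assms(3)] eq by (simp add: inj_on_def)
  qed
  moreover have "(\<lambda>e. v (smult [:c e:] (mon n e))) ` E = val n ` E" using eq by simp
  ultimately show ?thesis using assms(1,2) by (metis Min_in finite_imageI image_is_empty)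
qed

lemma v_eq_val:
  assumes "n \<ge> 1" "degree f < d n" "f \<noteq> 0"
  obtains e where "e \<in> exponents n" "v f = val n e"
proof -
  obtain E c where E: "finite E" "E \<noteq> {}" "E \<subseteq> exponents n" "\<forall>e\<in>E. c e \<noteq> 0"
    "f = (\<Sum>e\<in>E. smult [:c e:] (mon n e))"
    using expansion[OF assms] by (elim exE conjE)
  have "v f \<in> val n ` E" using v_expansion[OF E(1-3), of c] E(4,5) by simp
  then show ?thesis using E(3) that by blast
qed

text \<open>If \<open>mb l = 1\<close> from some index on, no new values enter the group and all
  \<open>\<gamma> k\<close> are integer multiples of one \<open>u\<close>. Dividing \<open>f\<close>
  by some \<open>Q l\<close> with \<open>\<gamma> l > v f\<close> leaves a remainder of the same
  value, again a multiple of \<open>u\<close>; so the value group would be infinite cyclic.\<close>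

lemma infinitely_many_jumps:
  assumes "\<not> isomorphic_to_int (value_group \<nu>)"
  shows "\<exists>l\<ge>L. mb l > 1"
proof (rule ccontr)
  assume none: "\<not> (\<exists>l\<ge>L. mb l > 1)"
  define L' where "L' = Suc L"
  have mb1: "mb l = 1" if "l \<ge> L'" for l
  proof -
    have "l \<ge> L" "l \<ge> 1" using that by (simp_all add: L'_def)
    then have "\<not> mb l > 1" "mb l > 0" using none mb_pos by blast+
    then show ?thesis by simp
  qed
  obtain u z e where u: "u = (\<Sum>k<L'. of_int (z k) * \<gamma> k)" "\<forall>k<L'. \<gamma> k = of_int (e k) * u"
    using cyclic_rat by blast
  have \<gamma>u: "\<exists>a. \<gamma> k = of_int a * u" for k
  proof (induction k rule: less_induct)
    case (less k)
    show ?case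
    proof (cases "k < L'")
      case True
      then show ?thesis using u(2) by blast
    next
      case False
      then have "k \<ge> 1" "mb k = 1" using mb1 by (auto simp: L'_def)
      then obtain c where c: "\<gamma> k = (\<Sum>i<k. of_nat (c i) * \<gamma> i)" using step[of k] by auto
      obtain a where a: "\<forall>i<k. \<gamma> i = of_int (a i) * u" using less by metis
      have "\<gamma> k = of_int (\<Sum>i<k. int (c i) * a i) * u"
        unfolding c using a by (simp add: sum_distrib_right mult.assoc)
      then show ?thesis ..
    qed
  qed
  then obtain a where a: "\<And>k. \<gamma> k = of_int (a k) * u" by metis
  have u0: "u \<noteq> 0" using a[of 0] \<gamma>_0 by auto
  \<comment> \<open>The \<open>\<gamma> l\<close> increase strictly within the multiples of
    \<open>u\<close>, so each step is at least the absolute value of \<open>u\<close>, whose sign is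
    not known.\<close>
  have unbounded: "\<exists>l\<ge>L'. \<gamma> l > B" for B
  proof -
    have "\<gamma> (L' + n) \<ge> of_nat n * \<bar>u\<bar>" for n
    proof (induction n)
      case 0
      then show ?case using \<gamma>_pos[of L'] by simp
    next
      case (Suc n)
      let ?b = "a (L' + Suc n) - a (L' + n)"
      have less: "\<gamma> (L' + n) < \<gamma> (L' + Suc n)" by (rule \<gamma>_less) (auto simp: L'_def)
      have eq: "\<gamma> (L' + Suc n) - \<gamma> (L' + n) = of_int ?b * u"
        by (simp only: a of_int_diff left_diff_distrib)
      then have "?b \<noteq> 0" using less by auto
      then have "\<bar>of_int ?b :: rat\<bar> \<ge> 1" by (simp flip: of_int_abs of_int_diff)
      then have "\<bar>of_int ?b :: rat\<bar> * \<bar>u\<bar> \<ge> \<bar>u\<bar>" by (simp add: mult_le_cancel_right1)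
      then have "\<gamma> (L' + Suc n) - \<gamma> (L' + n) \<ge> \<bar>u\<bar>"
        using less eq by (metis abs_mult abs_of_pos diff_gt_0_iff_gt)
      moreover have "of_nat (Suc n) * \<bar>u\<bar> = of_nat n * \<bar>u\<bar> + \<bar>u\<bar>" by (simp add: algebra_simps)
      ultimately show ?case using Suc by linarith
    qed
    moreover obtain n where "of_nat n * \<bar>u\<bar> > B"
      using u0 ex_less_of_nat_mult[of "\<bar>u\<bar>" B] by auto
    ultimately have "\<gamma> (L' + n) > B" by (meson less_le_trans)
    then show ?thesis using le_add1 by blast
  qed
  have vu: "\<exists>b. v f = of_int b * u" if f: "f \<noteq> 0" for f
  proof -
    obtain l where l: "l \<ge> L'" "\<gamma> l > v f" using unbounded by blast
    have l1: "l \<ge> 1" using l(1) by (simp add: L'_def)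
    have Ql: "lead_coeff (Q l) = 1" "degree (Q l) = d l" using monic_degree[OF l1] by auto
    have pos: "degree (Q l) > 0" using Ql(2) d_pos[of l] by simp
    obtain h r where hr: "f = h * Q l + r" "degree r < degree (Q l)"
      using monic_division[OF Ql(1) pos] by metis
    have hQ: "v (h * Q l) > v f" if "h \<noteq> 0"
      using v_mult[OF that Q_nonzero[of l]] v_nonneg[OF that] l(2) by (simp add: v_Q)
    have r0: "r \<noteq> 0" using hr(1) f hQ by (metis add.right_neutral less_irrefl mult_zero_left)
    have "v r = v f"
    proof (cases "h = 0")
      case True
      then show ?thesis using hr(1) by simp
    next
      case False
      then have hQ0: "h * Q l \<noteq> 0" by (simp add: Q_nonzero)
      have "r = f + - (h * Q l)" using hr(1) by simp
      then have "v r \<ge> min (v f) (v (h * Q l))"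
        using v_add[of f "- (h * Q l)"] f hQ0 r0 v_uminus[OF hQ0] by simp
      moreover have "v f \<ge> min (v (h * Q l)) (v r)"
        using v_add[of "h * Q l" r] f hQ0 r0 by (simp flip: hr(1))
      ultimately show ?thesis using hQ[OF False] by linarith
    qed
    moreover obtain e where "v r = val l e"
      using v_eq_val[OF l1 _ r0] hr(2) Ql(2) by metis
    moreover have "val l e = of_int (\<Sum>k<l. int (e k) * a k) * u"
      by (simp add: val_def a[of _] sum_distrib_right mult.assoc)
    ultimately show ?thesis by metis
  qed
  have "bij_betw (\<lambda>a. of_int a * u) UNIV (value_group \<nu>)"
    unfolding bij_betw_def
  proof
    show "inj (\<lambda>a. of_int a * u)" using u0 by (auto intro: injI)
    show "range (\<lambda>a. of_int a * u) = value_group \<nu>"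
    proof (intro equalityI subsetI)
      fix b assume "b \<in> range (\<lambda>a. of_int a * u)"
      then obtain s where s: "b = of_int s * u" by blast
      \<comment> \<open>The coefficients that write \<open>u\<close> through the
        \<open>\<gamma> k\<close> serve as exponents of an element of value
        \<open>u\<close>.\<close>
      let ?x = "\<Prod>k<L'. to_fract (Q k) powi z k"
      have "\<nu> ?x = (\<Sum>k<L'. \<nu> (to_fract (Q k) powi z k))"
        by (rule valuation_prod[OF valuation]) (simp add: Q_nonzero)
      also have "\<dots> = u"
        by (simp add: u(1) valuation_powi[OF valuation] Q_nonzero \<gamma>_eq)
      finally have x: "\<nu> ?x = u" .
      have "?x \<noteq> 0" by (simp add: Q_nonzero)
      then have "\<nu> (?x powi s) = b" "?x powi s \<noteq> 0"
        using x s valuation_powi[OF valuation] by auto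
      then show "b \<in> value_group \<nu>" unfolding value_group_def by blast
    next
      fix b assume "b \<in> value_group \<nu>"
      then obtain x where x: "x \<noteq> 0" "b = \<nu> x" by (auto simp: value_group_def)
      obtain f g where fg: "x = Fract f g" "g \<noteq> 0" by (cases x)
      then have f: "f \<noteq> 0" using x(1) by (auto simp: fract_collapse)
      have "b = v f - v g"
        using fg f x(2) valuation_divide[OF valuation] by (simp add: v_def Fract_conv_to_fract)
      moreover obtain s t where "v f = of_int s * u" "v g = of_int t * u"
        using vu f fg(2) by blast
      ultimately have "b = of_int (s - t) * u" by (simp add: left_diff_distrib)
      then show "b \<in> range (\<lambda>a. of_int a * u)" by blast
    qed
  qed
  then have "isomorphic_to_int (value_group \<nu>)"
    unfolding isomorphic_to_int_def by (intro exI[of _ "\<lambda>a. of_int a * u"]) (simp add: distrib_right)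
  then show False using assms by blast
qed

end

section \<open>Growth of degrees and the first relation\<close>

context key_sequence
begin

lemma d_mono: "k \<le> l \<Longrightarrow> d k \<le> d l"
proof (induction l rule: dec_induct)
  case (step l)
  have "d l \<le> d (Suc l)"
  proof (cases "l = 0")
    case False
    then have "d (Suc l) = mb l * d l" "mb l > 0" using d_Suc mb_pos by simp_all
    then show ?thesis by simp
  qed (simp add: d_def)
  then show ?case using step.IH by simp
qed simp

text \<open>Each jump at least doubles \<open>d\<close>. Hence every polynomial has degree below
  some \<open>d n\<close>, and the expansion applies to it.\<close>

lemma d_unbounded:
  assumes "\<And>L. \<exists>l\<ge>L. mb l > 1"
  shows "\<exists>n\<ge>L. N < d n"
proof (induction N)
  case 0
  then show ?case using d_pos by blast
next
  case (Suc N)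
  then obtain n where n: "n \<ge> L" "N < d n" by blast
  obtain l where l: "l \<ge> Suc n" "mb l > 1" using assms by blast
  have "d l \<ge> d n" using l by (intro d_mono) simp
  then have "Suc N \<le> d l" using n by simp
  also have "d l < 2 * d l" using d_pos[of l] by simp
  also have "\<dots> \<le> mb l * d l" using l by (intro mult_le_mono1) simp
  also have "\<dots> = d (Suc l)" using d_Suc[of l] l by simp
  finally show ?case using n l by (intro exI[of _ "Suc l"]) simp
qed

lemma val_ge:
  assumes "k < n" "e k > 0"
  shows "val n e \<ge> \<gamma> k"
proof -
  have "\<gamma> k \<le> of_nat (e k) * \<gamma> k" using assms(2) \<gamma>_pos[of k] by simp
  also have "\<dots> \<le> val n e" unfolding val_def
    by (rule member_le_sum) (use assms(1) less_imp_le[OF \<gamma>_pos] in simp_all)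
  finally show ?thesis .
qed

text \<open>This is the fraction \<open>\<gamma> 1 / \<gamma> 0\<close> in lowest terms: a common
  factor could be cancelled, against minimality of \<open>mb 1\<close>.\<close>

lemma first_relation:
  obtains a where "of_nat (mb 1) * \<gamma> 1 = of_nat a * \<gamma> 0" "coprime a (mb 1)"
proof -
  obtain c where c: "of_nat (mb 1) * \<gamma> 1 = (\<Sum>k<1. of_nat (c k) * \<gamma> k)"
    using step[of 1] by blast
  then have 1: "of_nat (mb 1) * \<gamma> 1 = of_nat (c 0) * \<gamma> 0" by simp
  define g where "g = gcd (c 0) (mb 1)"
  have mb: "mb 1 > 0" using mb_pos by simp
  then have g: "g > 0" by (simp add: g_def)
  obtain a b where ab: "c 0 = g * a" "mb 1 = g * b" unfolding g_def by (meson dvdE gcd_dvd1 gcd_dvd2)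
  have "of_nat b * \<gamma> 1 = of_nat a * \<gamma> 0" using 1 g unfolding ab by simp
  then have "of_nat b * \<gamma> 1 = (\<Sum>k<1. of_int (int a) * \<gamma> k)" by simp
  then have "mb 1 \<le> b" by (rule mb_least[rotated 2]) (use mb ab in auto)
  then have "g = 1" using ab mb g by (cases g) auto
  then have "coprime (c 0) (mb 1)" by (simp add: g_def coprime_iff_gcd_eq_1)
  then show ?thesis using that 1 by blast
qed

end

subsection \<open>Semigroups of values\<close>

lemma one_notin_max_ideal: "1 \<notin> max_ideal_XY"
  by (simp add: mem_max_ideal_XY_iff)

lemma zero_in_max_ideal: "0 \<in> max_ideal_XY"
  by (simp add: mem_max_ideal_XY_iff)

lemma dominates_R_loc_nonneg:
  assumes "dominates \<nu> R_loc R_loc_max" "f \<noteq> 0"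
  shows "\<nu> (to_fract f) \<ge> 0"
proof -
  have "to_fract f \<in> R_loc"
    using one_notin_max_ideal unfolding R_loc_def localization_def to_fract_def by blast
  then have "to_fract f \<in> valuation_ring \<nu>" using assms(1) by (auto simp: dominates_def)
  then show ?thesis using assms(2) by (simp add: valuation_ring_def)
qed

lemma dominates_R_loc_pos:
  assumes "dominates \<nu> R_loc R_loc_max" "f \<noteq> 0" "f \<in> max_ideal_XY"
  shows "\<nu> (to_fract f) > 0"
proof -
  have "to_fract f \<in> R_loc_max"
    using one_notin_max_ideal assms(3) unfolding R_loc_max_def localization_max_def to_fract_def by blast
  then have "to_fract f \<in> valuation_ideal \<nu>" using assms(1) by (auto simp: dominates_def)
  then show ?thesis using assms(2) by (simp add: valuation_ideal_def)
qed

lemma dominates_R_loc_zero: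
  assumes "valuation \<nu>" "dominates \<nu> R_loc R_loc_max" "g \<notin> max_ideal_XY"
  shows "g \<noteq> 0" "\<nu> (to_fract g) = 0"
proof -
  show g: "g \<noteq> 0" using assms(3) zero_in_max_ideal by auto
  have "1 / to_fract g = Fract 1 g" by (simp add: Fract_conv_to_fract)
  also have "\<dots> \<in> R_loc" using assms(3) unfolding R_loc_def localization_def by blast
  finally have "1 / to_fract g \<in> valuation_ring \<nu>" using assms(2) by (auto simp: dominates_def)
  then have "\<nu> (1 / to_fract g) \<ge> 0" using g by (simp add: valuation_ring_def)
  then have "\<nu> (to_fract g) \<le> 0"
    using g valuation_divide[OF assms(1), of 1 "to_fract g"] valuation_1[OF assms(1)] by simp
  then show "\<nu> (to_fract g) = 0" using dominates_R_loc_nonneg[OF assms(2) g] by simp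
qed

text \<open>Denominators lie outside the maximal ideal and have value 0, so localizing adds no
  values and the semigroups can be computed on polynomials.\<close>

lemma value_semigroup_localization:
  assumes "valuation \<nu>" "dominates \<nu> R_loc R_loc_max" "1 \<in> B"
  shows "value_semigroup (localization B (max_ideal_XY \<inter> B)) \<nu> = {\<nu> (to_fract f) | f. f \<in> B \<and> f \<noteq> 0}"
proof (intro equalityI subsetI)
  fix s assume "s \<in> value_semigroup (localization B (max_ideal_XY \<inter> B)) \<nu>"
  then obtain f g where fg: "s = \<nu> (Fract f g)" "Fract f g \<noteq> 0" "f \<in> B" "g \<notin> max_ideal_XY"
    by (auto simp: value_semigroup_def localization_def)
  note g = dominates_R_loc_zero[OF assms(1,2) fg(4)]
  have f: "f \<noteq> 0" using fg(2) by (auto simp: fract_collapse)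
  have "s = \<nu> (to_fract f)"
    using fg(1) f g valuation_divide[OF assms(1)] by (simp add: Fract_conv_to_fract)
  then show "s \<in> {\<nu> (to_fract f) | f. f \<in> B \<and> f \<noteq> 0}" using fg(3) f by blast
next
  fix s assume "s \<in> {\<nu> (to_fract f) | f. f \<in> B \<and> f \<noteq> 0}"
  then obtain f where f: "s = \<nu> (to_fract f)" "f \<in> B" "f \<noteq> 0" by blast
  have "to_fract f \<in> localization B (max_ideal_XY \<inter> B)"
    using f(2) assms(3) one_notin_max_ideal unfolding localization_def to_fract_def by blast
  then show "s \<in> value_semigroup (localization B (max_ideal_XY \<inter> B)) \<nu>"
    using f unfolding value_semigroup_def by auto
qed

lemma one_invariant: "1 \<in> invariants H"
  by (simp add: invariants_def comm_ring_morphism.hom_1[OF act_morphism])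

context valued_key_sequence
begin

text \<open>If \<open>Q l\<close> occurs in a monomial carrying the value of \<open>f\<close> or
  \<open>g\<close>, that value is at least \<open>\<gamma> l\<close> and the other one is 0.
  Otherwise only \<open>Q k\<close> with \<open>k < l\<close> occur, as later ones have too large a
  value; then \<open>\<gamma> l\<close> lies in the group of the earlier values, against
  \<open>mb l > 1\<close>.\<close>

lemma v_irreducible:
  assumes jumps: "\<And>L. \<exists>l\<ge>L. mb l > 1" and l: "l \<ge> 1" "mb l > 1"
    and fg: "f \<noteq> 0" "g \<noteq> 0" "v f + v g = \<gamma> l"
  shows "v f = \<gamma> l \<or> v g = \<gamma> l"
proof -
  obtain n where n: "n \<ge> Suc l" "max (degree f) (degree g) < d n" using d_unbounded[OF jumps] by blast
  have n1: "n \<ge> 1" using n by simp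
  obtain e where e: "v f = val n e" by (rule v_eq_val[OF n1 _ fg(1)]) (use n in auto)
  obtain e' where e': "v g = val n e'" by (rule v_eq_val[OF n1 _ fg(2)]) (use n in auto)
  note ge0 = v_nonneg[OF fg(1)] v_nonneg[OF fg(2)]
  show ?thesis
  proof (cases "e l > 0 \<or> e' l > 0")
    case True
    then show ?thesis using val_ge[of l n e] val_ge[of l n e'] n e e' ge0 fg(3) by auto
  next
    case False
    have 0: "e k = 0 \<and> e' k = 0" if "k < n" "k \<ge> l" for k
    proof (cases "k = l")
      case False
      then have "\<gamma> k > \<gamma> l" using that l by (intro \<gamma>_less) auto
      then have "\<not> e k > 0" "\<not> e' k > 0"
        using val_ge[of k n e] val_ge[of k n e'] that e e' ge0 fg(3) by auto
      then show ?thesis by simp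
    qed (use False in simp)
    have "\<gamma> l = (\<Sum>k<n. of_int (int (e k) + int (e' k)) * \<gamma> k)"
      using fg(3) by (simp add: e e' val_def sum.distrib distrib_right)
    also have "\<dots> = (\<Sum>k<l. of_int (int (e k) + int (e' k)) * \<gamma> k)"
      by (rule sum.mono_neutral_right) (use n 0 in \<open>auto simp: not_less\<close>)
    finally have "of_nat 1 * \<gamma> l = (\<Sum>k<l. of_int (int (e k) + int (e' k)) * \<gamma> k)" by simp
    then have "mb l \<le> 1" by (rule mb_least[rotated 2]) (use l in auto)
    then show ?thesis using l by simp
  qed
qed

text \<open>Each \<open>\<gamma> l\<close> with \<open>mb l > 1\<close> is an indecomposable element of the semigroup of \<open>\<nu>\<close>, so it must
  itself be a generator unless it is attained on the smaller ring.\<close>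
lemma not_finitely_generated:
  assumes jumps: "\<And>L. \<exists>l\<ge>L. mb l > 1"
    and B: "\<And>l f. l \<ge> 2 \<Longrightarrow> f \<in> B \<Longrightarrow> f \<noteq> 0 \<Longrightarrow> v f \<noteq> \<gamma> l"
  shows "\<not> finitely_generated_over {v f | f. f \<noteq> 0} {v f | f. f \<in> B \<and> f \<noteq> 0}"
proof
  assume "finitely_generated_over {v f | f. f \<noteq> 0} {v f | f. f \<in> B \<and> f \<noteq> 0}"
  then obtain F where F: "finite F" "F \<subseteq> {v f | f. f \<noteq> 0}"
    "{v f | f. f \<noteq> 0} = {s + u | s u. s \<in> F \<and> u \<in> {v f | f. f \<in> B \<and> f \<noteq> 0}}"
    unfolding finitely_generated_over_def by blast
  define I where "I = {l. l \<ge> 2 \<and> mb l > 1}"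
  have "infinite I"
    unfolding infinite_nat_iff_unbounded_le I_def using jumps by (metis (no_types, lifting) max.bounded_iff mem_Collect_eq)
  moreover have "inj_on \<gamma> I"
  proof (rule linorder_inj_onI)
    show "\<gamma> k \<noteq> \<gamma> l" if "k < l" "k \<in> I" "l \<in> I" for k l
      using \<gamma>_less[of k l] that by (auto simp: I_def)
  qed auto
  ultimately have "infinite (\<gamma> ` I)" by (simp add: finite_image_iff)
  moreover have "\<gamma> ` I \<subseteq> F"
  proof
    fix s assume "s \<in> \<gamma> ` I"
    then obtain l where l: "s = \<gamma> l" "l \<ge> 2" "mb l > 1" by (auto simp: I_def)
    have "\<gamma> l \<in> {v f | f. f \<noteq> 0}" using v_Q[of l] Q_nonzero[of l] by (metis (mono_tags, lifting) mem_Collect_eq)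
    then obtain a b where ab: "\<gamma> l = a + b" "a \<in> F" "b \<in> {v f | f. f \<in> B \<and> f \<noteq> 0}"
      unfolding F(3) by blast
    obtain f where f: "a = v f" "f \<noteq> 0" using F(2) ab(2) by blast
    obtain g where g: "b = v g" "g \<noteq> 0" "g \<in> B" using ab(3) by blast
    have "v f = \<gamma> l \<or> v g = \<gamma> l"
      by (rule v_irreducible[OF jumps _ l(3) f(2) g(2)]) (use ab(1) f g l in auto)
    then have "v f = \<gamma> l" using B[OF l(2) g(3,2)] by blast
    then show "s \<in> F" using l f ab by simp
  qed
  ultimately show False using F(1) finite_subset by blast
qed

text \<open>Rounding the exponents of X and Y down to multiples of \<open>M\<close> and
  \<open>N\<close> turns any monomial into one from \<open>B\<close>; finitely many values of
  \<open>X^a * Y^b\<close> account for the difference.\<close>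

lemma finitely_generated:
  assumes jumps: "\<And>L. \<exists>l\<ge>L. mb l > 1" and MN: "M > 0" "N > 0"
    and B: "\<And>n e. M dvd e 0 \<Longrightarrow> N dvd e 1 \<Longrightarrow> mon n e \<in> B"
  shows "finitely_generated_over {v f | f. f \<noteq> 0} {v f | f. f \<in> B \<and> f \<noteq> 0}"
proof -
  define h where "h a b = v (Q 0 ^ a * Q 1 ^ b)" for a b
  define F where "F = (\<lambda>(a, b). h a b) ` ({..<M} \<times> {..<N})"
  have h: "h a b = of_nat a * \<gamma> 0 + of_nat b * \<gamma> 1" for a b
    by (simp add: h_def v_mult v_power v_Q Q_nonzero)
  have "finite F" by (simp add: F_def)
  moreover have "F \<subseteq> {v f | f. f \<noteq> 0}" unfolding F_def h_def using Q_nonzero by fastforce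
  moreover have "{v f | f. f \<noteq> 0} = {s + u | s u. s \<in> F \<and> u \<in> {v f | f. f \<in> B \<and> f \<noteq> 0}}"
  proof (intro equalityI subsetI)
    fix s assume "s \<in> {v f | f. f \<noteq> 0}"
    then obtain f where f: "s = v f" "f \<noteq> 0" by blast
    \<comment> \<open>\<open>n \<ge> 2\<close> makes the exponents of both X and Y part of the sums
      over \<open>k < n\<close>.\<close>
    obtain n where n: "n \<ge> 2" "degree f < d n" using d_unbounded[OF jumps] by blast
    obtain e where e: "v f = val n e" by (rule v_eq_val[OF _ n(2) f(2)]) (use n in auto)
    define e' where "e' = e(0 := e 0 - e 0 mod M, 1 := e 1 - e 1 mod N)"
    have e'_eq: "int (e k) = int (e' k) + (if k = 0 then int (e 0 mod M) else 0) + (if k = 1 then int (e 1 mod N) else 0)" for k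
      by (auto simp: e'_def of_nat_diff)
    have "val n e = (\<Sum>k<n. of_nat (e' k) * \<gamma> k + (if k = 0 then of_nat (e 0 mod M) * \<gamma> 0 else 0) +
        (if k = 1 then of_nat (e 1 mod N) * \<gamma> 1 else 0))"
      unfolding val_def
    proof (intro sum.cong refl)
      fix k
      have "of_nat (e k) = (of_int (int (e k)) :: rat)" by simp
      then show "of_nat (e k) * \<gamma> k = of_nat (e' k) * \<gamma> k +
          (if k = 0 then of_nat (e 0 mod M) * \<gamma> 0 else 0) + (if k = 1 then of_nat (e 1 mod N) * \<gamma> 1 else 0)"
        unfolding e'_eq by (auto simp: distrib_right)
    qed
    also have "\<dots> = val n e' + h (e 0 mod M) (e 1 mod N)"
      using n(1) by (simp add: sum.distrib val_def h)
    finally have "s = h (e 0 mod M) (e 1 mod N) + v (mon n e')" using f e by (simp add: v_mon)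
    moreover have "h (e 0 mod M) (e 1 mod N) \<in> F" unfolding F_def using MN by force
    moreover have "mon n e' \<in> B" by (rule B) (simp_all add: e'_def minus_mod_eq_mult_div)
    ultimately show "s \<in> {s + u | s u. s \<in> F \<and> u \<in> {v f | f. f \<in> B \<and> f \<noteq> 0}}"
      using mon_nonzero by blast
  next
    fix s assume "s \<in> {s + u | s u. s \<in> F \<and> u \<in> {v f | f. f \<in> B \<and> f \<noteq> 0}}"
    then obtain a b f where "s = h a b + v f" "f \<noteq> 0" by (auto simp: F_def)
    then have "s = v (Q 0 ^ a * Q 1 ^ b * f)" "Q 0 ^ a * Q 1 ^ b * f \<noteq> 0"
      by (simp_all add: h_def v_mult Q_nonzero)
    then show "s \<in> {v f | f. f \<noteq> 0}" by blast
  qed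
  ultimately show ?thesis unfolding finitely_generated_over_def by blast
qed

end

section \<open>Weights and values of invariant polynomials\<close>

locale valued_key_sequence_eigen = valued_key_sequence Q mb \<gamma> \<nu> + key_sequence_eigen Q mb \<gamma> p q
  for Q :: "nat \<Rightarrow> 'k::field poly poly" and mb \<gamma> \<nu> and p q :: 'k
begin

text \<open>Reduced monomials are independent, so an invariant polynomial contains only those of
  trivial weight. One of them carries the value \<open>\<gamma> l\<close>, and monomials of equal
  value have equal weight.\<close>

lemma invariant_weight:
  assumes jumps: "\<And>L. \<exists>l\<ge>L. mb l > 1"
    and f: "f \<noteq> 0" "act (p, q) f = f" "v f = \<gamma> l"
  shows "w l = 1"
proof -
  obtain n where n: "n \<ge> Suc l" "degree f < d n" using d_unbounded[OF jumps] by blast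
  have n1: "n \<ge> 1" using n by simp
  obtain E c where E: "finite E" "E \<noteq> {}" "E \<subseteq> exponents n" "\<forall>e\<in>E. c e \<noteq> 0"
    "f = (\<Sum>e\<in>E. smult [:c e:] (mon n e))"
    using expansion[OF n1 n(2) f(1)] by (elim exE conjE)
  define W where "W e = (\<Prod>k<n. w k ^ e k)" for e :: "nat \<Rightarrow> nat"
  have act: "act (p, q) f = (\<Sum>e\<in>E. smult [:c e * W e:] (mon n e))"
    unfolding E(5) comm_ring_morphism.hom_sum[OF act_morphism] act_smult_const act_mon W_def
    by (simp add: mult.commute)
  have "0 = act (p, q) f - f" using f(2) by simp
  also have "\<dots> = (\<Sum>e\<in>E. smult [:c e * W e:] (mon n e) - smult [:c e:] (mon n e))"
    by (simp only: act sum_subtractf E(5)[symmetric])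
  also have "\<dots> = (\<Sum>e\<in>E. smult [:c e * (W e - 1):] (mon n e))"
    unfolding smult_diff_left[symmetric] by (simp add: algebra_simps)
  also have "\<dots> = (\<Sum>e\<in>{e\<in>E. W e \<noteq> 1}. smult [:c e * (W e - 1):] (mon n e))"
    using E(1) by (intro sum.mono_neutral_right) auto
  finally have 0: "(\<Sum>e\<in>{e\<in>E. W e \<noteq> 1}. smult [:c e * (W e - 1):] (mon n e)) = 0" by simp
  have W1: "W e = 1" if "e \<in> E" for e
  proof (rule ccontr)
    assume "W e \<noteq> 1"
    then have "{e\<in>E. W e \<noteq> 1} \<noteq> {}" using that by blast
    from v_expansion[of "{e\<in>E. W e \<noteq> 1}" n "\<lambda>e. c e * (W e - 1)", OF _ this] E(1,3,4) 0
    show False by auto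
  qed
  obtain e where e: "e \<in> E" "v f = val n e"
    using v_expansion[OF E(1-3), of c] E(4,5) by auto
  have "(\<Sum>k<n. of_int (int (e k) - (if k = l then 1 else 0)) * \<gamma> k) =
      val n e - (\<Sum>k<n. if k = l then \<gamma> k else 0)"
    unfolding val_def sum_subtractf[symmetric] by (intro sum.cong) (auto simp: algebra_simps)
  also have "\<dots> = 0" using e f(3) n(1) by simp
  finally have "1 = (\<Prod>k<n. w k powi (int (e k) - (if k = l then 1 else 0)))"
    using w_relation by metis
  also have "\<dots> = (\<Prod>k<n. w k ^ e k / (if k = l then w k else 1))"
    by (intro prod.cong) (auto simp: power_int_diff w_nonzero)
  also have "\<dots> = W e / w l"
    using n(1) by (simp add: prod_dividef W_def)
  finally show ?thesis using W1[OF e(1)] w_nonzero[of l] by (simp add: field_simps)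
qed

end

context key_sequence_eigen
begin

lemma w_first_relation:
  assumes "of_nat (mb 1) * \<gamma> 1 = of_nat a * \<gamma> 0"
  shows "p ^ a = q ^ mb 1"
proof -
  obtain c where c: "of_nat (mb 1) * \<gamma> 1 = (\<Sum>k<1. of_nat (c k) * \<gamma> k)"
    "(\<Prod>k<1. w k ^ c k) = w 1 ^ mb 1"
    by (rule w_step[of 1]) auto
  have "a = c 0" using assms c(1) \<gamma>_0 by simp
  then show ?thesis using c(2) by (simp add: w_def d_1)
qed

text \<open>\<open>d l\<close> is \<open>mb 1\<close> times a factor prime to \<open>r\<close>. If
  \<open>w l\<close> were 1, the order of \<open>\<xi>\<close> would force
  \<open>r dvd mb 1\<close>; rewriting \<open>q ^ mb 1\<close> as \<open>p ^ a\<close>, the order of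
  \<open>p\<close> would force \<open>r dvd a\<close>. But \<open>a\<close> and \<open>mb 1\<close>
  are coprime.\<close>

lemma w_neq_1:
  assumes l: "l \<ge> 2" and r: "prime r" "r dvd M" "r dvd N" and x: "\<not> r dvd x"
    and p: "primitive_root_of_unity M p" and q: "q = \<xi> ^ x" "primitive_root_of_unity N \<xi>"
  shows "w l \<noteq> 1"
proof
  assume w1: "w l = 1"
  obtain a where a: "of_nat (mb 1) * \<gamma> 1 = of_nat a * \<gamma> 0" "coprime a (mb 1)"
    by (rule first_relation)
  define D where "D = (\<Prod>k\<in>{2..<l}. mb k)"
  have dl: "d l = mb 1 * D"
    unfolding d_def D_def using l by (subst prod.atLeast_Suc_lessThan) (auto simp: numeral_2_eq_2)
  have rD: "\<not> r dvd D"
  proof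
    assume "r dvd D"
    then obtain k where "k \<in> {2..<l}" "r dvd mb k"
      unfolding D_def using prime_dvd_prod_iff[OF _ r(1)] by blast
    then show False using mb_coprime_order[OF _ r(1,2) p] by auto
  qed
  have qD: "q ^ (mb 1 * D) = 1" using w1 l by (simp add: w_def dl)
  then have "\<xi> ^ (x * (mb 1 * D)) = 1" by (simp add: q(1) power_mult)
  then have "N dvd x * (mb 1 * D)" using primitive_root_power_eq_1_iff[OF q(2)] by simp
  then have "r dvd x * (mb 1 * D)" using r(3) by (rule dvd_trans[rotated])
  then have "r dvd mb 1" using x rD r(1) by (simp add: prime_dvd_mult_iff)
  moreover have "p ^ (a * D) = 1"
    using qD w_first_relation[OF a(1)] by (simp add: power_mult)
  then have "M dvd a * D" using primitive_root_power_eq_1_iff[OF p] by simp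
  then have "r dvd a * D" using r(2) by (rule dvd_trans[rotated])
  then have "r dvd a" using rD r(1) by (simp add: prime_dvd_mult_iff)
  ultimately show False using a(2) r(1) by (meson coprime_common_divisor_nat not_prime_1 coprime_common_divisor not_prime_unit)
qed

end

lemma generating_sequence_valued_key_sequence:
  assumes \<nu>: "rank1_nondiscrete_dominating \<nu>" and Q: "generating_sequence \<nu> Q"
  shows "valued_key_sequence Q (gs_mbar \<nu> Q) (gs_value \<nu> Q) \<nu>"
proof -
  let ?\<gamma> = "gs_value \<nu> Q" and ?mb = "gs_mbar \<nu> Q"
  have val: "valuation \<nu>" and dom: "dominates \<nu> R_loc R_loc_max"
    using \<nu> by (simp_all add: rank1_nondiscrete_dominating_def)
  have Q01: "Q 0 = varX" "Q (Suc 0) = varY" using Q by (simp_all add: generating_sequence_def)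
  have g0: "?\<gamma> 0 > 0" and g1: "?\<gamma> (Suc 0) > 0"
    unfolding gs_value_def Q01
    by (rule dominates_R_loc_pos[OF dom]; simp add: mem_max_ideal_XY_iff varX_def varY_def)+
  \<comment> \<open>Rational values are commensurable with \<open>\<gamma> 0\<close>, so the
    \<open>LEAST\<close> that defines \<open>gs_mbar\<close> ranges over a nonempty set.\<close>
  have ex: "\<exists>q>0. \<exists>z. of_nat q * ?\<gamma> l = (\<Sum>k<l. of_int (z k) * ?\<gamma> k)" if l: "l \<ge> 1" for l
  proof -
    obtain a b where ab: "quotient_of (?\<gamma> l / ?\<gamma> 0) = (a, b)" by force
    then have b: "b > 0" "?\<gamma> l / ?\<gamma> 0 = of_int a / of_int b"
      using quotient_of_denom_pos quotient_of_div by blast+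
    then have "of_nat (nat b) * ?\<gamma> l = of_int a * ?\<gamma> 0"
      using g0 by (simp add: field_simps of_nat_nat)
    also have "\<dots> = (\<Sum>k<l. if k = 0 then of_int a * ?\<gamma> 0 else 0)" using l by simp
    also have "\<dots> = (\<Sum>k<l. of_int (if k = 0 then a else 0) * ?\<gamma> k)" by (intro sum.cong) auto
    finally show ?thesis using b(1) by (metis zero_less_nat_eq)
  qed
  show ?thesis
  proof
    show "?mb l > 0" if "l \<ge> 1" for l
      unfolding gs_mbar_def using LeastI_ex[OF ex[OF that]] by blast
    show "?mb l \<le> q" if "l \<ge> 1" "q > 0" "of_nat q * ?\<gamma> l = (\<Sum>k<l. of_int (z k) * ?\<gamma> k)" for l q z
      unfolding gs_mbar_def by (rule Least_le) (use that in blast)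
    show "\<exists>c \<mu>. (\<forall>k. 1 \<le> k \<and> k < l \<longrightarrow> c k < ?mb k) \<and>
        of_nat (?mb l) * ?\<gamma> l = (\<Sum>k<l. of_nat (c k) * ?\<gamma> k) \<and> \<mu> \<noteq> 0 \<and>
        Q (Suc l) = Q l ^ ?mb l - smult [:\<mu>:] (\<Prod>k<l. Q k ^ c k) \<and>
        ?\<gamma> (Suc l) > of_nat (?mb l) * ?\<gamma> l" if "l \<ge> 1" for l
      using Q that unfolding generating_sequence_def by blast
    show "\<nu> (to_fract f) \<ge> 0" if "f \<noteq> 0" for f using dominates_R_loc_nonneg[OF dom that] .
  qed (use g0 g1 in \<open>simp_all add: Q01 val gs_value_def\<close>)
qed

subsection \<open>Finite subgroups of the torus\<close>

lemma powi_mult_int: "z powi (int i * a) = (z ^ i) powi a" "z powi (a * int i) = (z ^ i) powi a"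
  for z :: "'a::field"
  by (simp_all add: power_int_power mult.commute)

locale group_data =
  fixes \<alpha> \<beta> :: "'k::field" and m n i j t x :: nat
  assumes \<alpha>: "primitive_root_of_unity m \<alpha>" and \<beta>: "primitive_root_of_unity n \<beta>"
    and adm: "admissible m n i j t x"
begin

abbreviation "M \<equiv> m div i"
abbreviation "N \<equiv> n div j"
abbreviation "H \<equiv> H_group \<alpha> \<beta> i j t x"

lemma \<zeta>: "primitive_root_of_unity M (\<alpha> ^ i)"
  using adm \<alpha> by (intro primitive_root_power) (auto simp: admissible_def)

lemma \<xi>: "primitive_root_of_unity N (\<beta> ^ j)"
  using adm \<beta> by (intro primitive_root_power) (auto simp: admissible_def)

lemma t_dvd: "t dvd M" "t dvd N" "t > 0" "coprime x t"
  using adm by (auto simp: admissible_def)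

lemma M_pos: "M > 0" and N_pos: "N > 0"
  using \<zeta> \<xi> by (simp_all add: primitive_root_of_unity_def)

lemma H_memI:
  assumes "[int b = int a * int x] (mod int t)"
  shows "((\<alpha> ^ i) ^ a, (\<beta> ^ j) ^ b) \<in> H"
proof -
  have "((\<alpha> ^ i) ^ a, (\<beta> ^ j) ^ b) = (\<alpha> powi (int a * int i), \<beta> powi (int b * int j))"
    by (simp add: powi_mult_int)
  then show ?thesis using assms unfolding H_group_def by blast
qed

lemma H_memE:
  assumes "(p, q) \<in> H"
  obtains a b where "p = (\<alpha> ^ i) powi a" "q = (\<beta> ^ j) powi b" "[b = a * int x] (mod int t)"
  using assms unfolding H_group_def by (auto simp: powi_mult_int)

lemma H_powers:
  assumes "(p, q) \<in> H"
  shows "p ^ M = 1" "q ^ N = 1" "p \<noteq> 0" "q \<noteq> 0"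
proof -
  obtain a b where ab: "p = (\<alpha> ^ i) powi a" "q = (\<beta> ^ j) powi b" using assms by (rule H_memE)
  show "p ^ M = 1" "q ^ N = 1"
    by (simp_all add: ab power_int_power' primitive_root_powi_eq_1_iff[OF \<zeta>]
        primitive_root_powi_eq_1_iff[OF \<xi>])
  show "p \<noteq> 0" "q \<noteq> 0" using primitive_root_nonzero[OF \<zeta>] primitive_root_nonzero[OF \<xi>] ab by auto
qed

end

section \<open>Generating sequences that consist of eigenfunctions\<close>

locale eigen_data = group_data +
  fixes \<nu> :: "'a poly poly fract \<Rightarrow> rat" and Q
  assumes \<nu>: "rank1_nondiscrete_dominating \<nu>" and gen: "generating_sequence \<nu> Q"
    and eigenfunctions: "\<And>l. eigenfunction H (Q l)"
begin

sublocale valued_key_sequence Q "gs_mbar \<nu> Q" "gs_value \<nu> Q" \<nu>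
  by (rule generating_sequence_valued_key_sequence[OF \<nu> gen])

lemma jumps: "\<exists>l\<ge>L. gs_mbar \<nu> Q l > 1"
  using \<nu> by (intro infinitely_many_jumps) (simp add: rank1_nondiscrete_dominating_def)

lemma eigen_locale:
  assumes "(p, q) \<in> H"
  shows "valued_key_sequence_eigen Q (gs_mbar \<nu> Q) (gs_value \<nu> Q) \<nu> p q"
proof
  show "\<exists>c. act (p, q) (Q l) = smult [:c:] (Q l)" for l
    using eigenfunctions[of l] assms by (auto simp: eigenfunction_def)
qed (use H_powers[OF assms] in auto)

lemma eigen_locale': "(p, q) \<in> H \<Longrightarrow> key_sequence_eigen Q (gs_mbar \<nu> Q) (gs_value \<nu> Q) p q"
  using eigen_locale valued_key_sequence_eigen.axioms(2) by blast

lemma semigroup_R: "value_semigroup R_loc \<nu> = {v f | f. f \<noteq> 0}"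
  using value_semigroup_localization[of \<nu> UNIV] \<nu>
  by (simp add: R_loc_def v_def rank1_nondiscrete_dominating_def)

lemma semigroup_A: "value_semigroup (A_loc H) \<nu> = {v f | f. f \<in> invariants H \<and> f \<noteq> 0}"
  using value_semigroup_localization[OF _ _ one_invariant, of \<nu> H] \<nu>
  by (simp add: A_loc_def v_def rank1_nondiscrete_dominating_def)

lemma N_dvd: "N dvd t * gs_mbar \<nu> Q 1"
proof -
  obtain a where a: "of_nat (gs_mbar \<nu> Q 1) * gs_value \<nu> Q 1 = of_nat a * gs_value \<nu> Q 0"
    by (rule first_relation)
  have "((\<alpha> ^ i) ^ 0, (\<beta> ^ j) ^ t) \<in> H" by (rule H_memI) (simp add: cong_def)
  from key_sequence_eigen.w_first_relation[OF eigen_locale'[OF this] a]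
  have "(\<beta> ^ j) ^ (t * gs_mbar \<nu> Q 1) = 1" by (simp add: power_mult)
  then show ?thesis using primitive_root_power_eq_1_iff[OF \<xi>] by simp
qed

lemma gcd_eq: "gcd M N = t"
proof -
  obtain a where a: "of_nat (gs_mbar \<nu> Q 1) * gs_value \<nu> Q 1 = of_nat a * gs_value \<nu> Q 0"
    "coprime a (gs_mbar \<nu> Q 1)"
    by (rule first_relation)
  have "((\<alpha> ^ i) ^ t, (\<beta> ^ j) ^ 0) \<in> H" by (rule H_memI) (simp add: cong_def)
  from key_sequence_eigen.w_first_relation[OF eigen_locale'[OF this] a(1)]
  have "(\<alpha> ^ i) ^ (t * a) = 1" by (simp add: power_mult)
  then have "M dvd t * a" using primitive_root_power_eq_1_iff[OF \<zeta>] by simp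
  then have "gcd M N dvd gcd (t * a) (t * gs_mbar \<nu> Q 1)"
    using N_dvd by (meson dvd_trans gcd_dvd1 gcd_dvd2 gcd_greatest)
  also have "gcd (t * a) (t * gs_mbar \<nu> Q 1) = t"
    using a(2) by (simp add: gcd_mult_distrib_nat[symmetric])
  finally show ?thesis using t_dvd by (simp add: dvd_antisym)
qed

lemma fg_if_trivial:
  assumes t: "t = 1"
  shows "finitely_generated_over (value_semigroup R_loc \<nu>) (value_semigroup (A_loc H) \<nu>)"
  unfolding semigroup_R semigroup_A
proof (rule finitely_generated[OF jumps M_pos N_pos])
  fix k and e :: "nat \<Rightarrow> nat" assume e: "M dvd e 0" "N dvd e 1"
  show "mon k e \<in> invariants H"
    unfolding invariants_def
  proof (intro CollectI ballI)
    fix g assume "g \<in> H"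
    moreover obtain p q where g: "g = (p, q)" by (cases g)
    ultimately have pq: "(p, q) \<in> H" by simp
    interpret key_sequence_eigen Q "gs_mbar \<nu> Q" "gs_value \<nu> Q" p q by (rule eigen_locale'[OF pq])
    have power_1: "a ^ l = 1" if "a ^ k = 1" "k dvd l" for a :: 'a and k l :: nat
      using that by (auto simp: power_mult)
    have "w l ^ e l = 1" for l :: nat
    proof -
      consider "l = 0" | "l = 1" | "l \<ge> 2" by linarith
      then show ?thesis
      proof cases
        case 1
        then show ?thesis using power_1[OF H_powers(1)[OF pq] e(1)] by (simp add: w_def)
      next
        case 2
        then show ?thesis using power_1[OF H_powers(2)[OF pq] e(2)] by (simp add: w_def d_1)
      next
        case 3
        \<comment> \<open>For \<open>t = 1\<close>, \<open>N\<close> divides this number and hence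
          \<open>d l\<close>, so \<open>Q l\<close> itself is invariant, whatever its
          exponent.\<close>
        have "gs_mbar \<nu> Q 1 dvd d l" unfolding d_def using 3 by (intro dvd_prodI) auto
        then have "N dvd d l" using N_dvd t by (auto intro: dvd_trans)
        then show ?thesis using power_1[OF H_powers(2)[OF pq]] 3 by (simp add: w_def)
      qed
    qed
    then show "act g (mon k e) = mon k e" by (simp add: g act_mon flip: one_pCons)
  qed
qed

lemma not_fg_if_nontrivial:
  assumes t: "t > 1"
  shows "\<not> finitely_generated_over (value_semigroup R_loc \<nu>) (value_semigroup (A_loc H) \<nu>)"
  unfolding semigroup_R semigroup_A
proof (rule not_finitely_generated[OF jumps])
  fix l :: nat and f assume l: "l \<ge> 2" and f: "f \<in> invariants H" "f \<noteq> 0"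
  obtain r where r: "prime r" "r dvd t" using t prime_factor_nat[of t] by auto
  have x: "\<not> r dvd x" using t_dvd(4) r by (meson coprime_common_divisor not_prime_unit)
  \<comment> \<open>A single test element suffices: \<open>a = 1\<close> makes the first coordinate
    a primitive root of order \<open>M\<close>, and \<open>b = x\<close> is an exponent that
    \<open>r\<close> does not divide.\<close>
  have pq: "((\<alpha> ^ i) ^ 1, (\<beta> ^ j) ^ x) \<in> H" by (rule H_memI) simp
  interpret valued_key_sequence_eigen Q "gs_mbar \<nu> Q" "gs_value \<nu> Q" \<nu> "(\<alpha> ^ i) ^ 1" "(\<beta> ^ j) ^ x"
    by (rule eigen_locale[OF pq])
  have "act ((\<alpha> ^ i) ^ 1, (\<beta> ^ j) ^ x) f = f" using f(1) pq by (auto simp: invariants_def)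
  moreover have "w l \<noteq> 1"
    by (rule w_neq_1[OF l r(1) dvd_trans[OF r(2) t_dvd(1)] dvd_trans[OF r(2) t_dvd(2)] x _ refl \<xi>])
      (use \<zeta> in simp)
  ultimately show "v f \<noteq> gs_value \<nu> Q l" using invariant_weight[OF jumps f(2)] by blast
qed

end

section \<open>Roots of unity and exponents compatible with the group\<close>

lemma primitive_root_dvd_coprime_power:
  assumes z: "primitive_root_of_unity t z" and s: "coprime s t"
  shows "primitive_root_of_unity t (z ^ s)"
proof -
  have "(z ^ s) ^ k = 1 \<longleftrightarrow> t dvd k" for k
    using primitive_root_power_eq_1_iff[OF z, of "s * k"] s
    by (simp add: power_mult coprime_dvd_mult_right_iff coprime_commute)
  moreover have "t > 0" using z by (simp add: primitive_root_of_unity_def)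
  ultimately show ?thesis by (simp add: primitive_root_of_unity_def nat_dvd_not_less)
qed

text \<open>The first \<open>t\<close> powers of \<open>z\<close> are distinct roots of a polynomial
  of degree \<open>t\<close>, so they exhaust its roots.\<close>

lemma root_of_unity_is_power:
  fixes z y :: "'a::field"
  assumes z: "primitive_root_of_unity t z" and y: "y ^ t = 1"
  obtains s where "y = z ^ s"
proof -
  have t: "t > 0" using z by (simp add: primitive_root_of_unity_def)
  define P :: "'a poly" where "P = monom 1 t - 1"
  have "coeff P t = 1" using t by (simp add: P_def)
  then have P: "P \<noteq> 0" by auto
  have deg: "degree P \<le> t" unfolding P_def by (intro degree_diff_le) (simp_all add: degree_monom_eq)
  have roots: "{u. poly P u = 0} = {u. u ^ t = 1}" by (simp add: P_def poly_monom)
  have inj: "inj_on (\<lambda>k. z ^ k) {..<t}"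
  proof (rule linorder_inj_onI)
    fix k l assume kl: "k < l" "k \<in> {..<t}" "l \<in> {..<t}"
    show "z ^ k \<noteq> z ^ l"
    proof
      assume "z ^ k = z ^ l"
      also have "\<dots> = z ^ k * z ^ (l - k)" using kl by (simp flip: power_add)
      finally have "z ^ (l - k) = 1" using primitive_root_nonzero[OF z] by simp
      then have "t dvd l - k" using primitive_root_power_eq_1_iff[OF z] by simp
      then show False using kl dvd_imp_le[of t "l - k"] by auto
    qed
  qed auto
  have sub: "(\<lambda>k. z ^ k) ` {..<t} \<subseteq> {u. u ^ t = 1}"
    using primitive_root_power_eq_1_iff[OF z] by (auto simp flip: power_mult)
  have fin: "finite {u::'a. u ^ t = 1}" using poly_roots_finite[OF P] roots by simp
  have "card {u::'a. u ^ t = 1} \<le> t" using card_poly_roots_bound[OF P] roots deg by simp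
  also have "t = card ((\<lambda>k. z ^ k) ` {..<t})" using inj by (simp add: card_image)
  finally have "(\<lambda>k. z ^ k) ` {..<t} = {u. u ^ t = 1}" by (intro card_seteq fin sub)
  then show ?thesis using y that by blast
qed

lemma coprime_in_residue_class:
  fixes s t A :: nat
  assumes st: "coprime s t" and A: "A > 0"
  obtains k where "k > 0" "coprime (s + t * k) A"
proof -
  \<comment> \<open>With this choice each prime factor of \<open>A\<close> divides exactly one of
    \<open>s\<close> and \<open>t * k\<close>, so none divides their sum.\<close>
  define k where "k = \<Prod>{r \<in> prime_factors A. \<not> r dvd s}"
  have fin: "finite {r \<in> prime_factors A. \<not> r dvd s}" by simp
  have "k > 0" unfolding k_def by (intro prod_pos) (auto intro!: prime_gt_0_nat)
  moreover have "coprime (s + t * k) A"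
  proof (rule ccontr)
    assume "\<not> coprime (s + t * k) A"
    then obtain r where r: "prime r" "r dvd s + t * k" "r dvd A"
      using prime_factor_nat[of "gcd (s + t * k) A"] by (auto simp: coprime_iff_gcd_eq_1)
    show False
    proof (cases "r dvd s")
      case True
      then have "r dvd t * k" using r(2) by (simp add: dvd_add_right_iff)
      moreover have "\<not> r dvd t" using True st r(1) by (meson coprime_common_divisor not_prime_unit)
      ultimately have "r dvd k" using r(1) by (simp add: prime_dvd_mult_iff)
      then obtain r' where r': "r' \<in> prime_factors A" "\<not> r' dvd s" "r dvd r'"
        unfolding k_def using prime_dvd_prod_iff[OF fin r(1), of "\<lambda>r. r"] by auto
      then have "r = r'" using r(1) by (intro primes_dvd_imp_eq) auto
      then show False using True r'(2) by simp
    next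
      case False
      then have "r dvd k" unfolding k_def using r A
        by (intro dvd_prodI[OF fin, of _ "\<lambda>r. r"]) (auto simp: prime_factors_dvd)
      then show False using False r(2) by (simp add: dvd_add_left_iff)
    qed
  qed
  ultimately show ?thesis by (rule that)
qed

text \<open>The equation \<open>r ^ q = p ^ c\<close> on \<open>H\<close> says that
  \<open>Y^q\<close> and \<open>X^c\<close> have the same weight, so that their difference is an
  eigenfunction. Coprimality lets \<open>c / q\<close> serve as the value of Y in lowest
  terms.\<close>

lemma (in group_data) compatible_exponents:
  assumes "gcd M N = t"
  obtains c q where "c > 0" "q > 0" "coprime c q" "\<And>p r. (p, r) \<in> H \<Longrightarrow> r ^ q = p ^ c"
proof -
  define M' where "M' = M div t"
  define N' where "N' = N div t"
  have MN: "M = M' * t" "N = N' * t" using t_dvd by (simp_all add: M'_def N'_def)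
  have pos: "M' > 0" "N' > 0" using M_pos N_pos unfolding MN by auto
  have cop: "coprime M' N'" unfolding M'_def N'_def using assms M_pos div_gcd_coprime by blast
  have \<theta>: "primitive_root_of_unity t ((\<alpha> ^ i) ^ M')"
    using primitive_root_power[OF \<zeta>, of M'] pos by (simp add: MN)
  have \<eta>0: "primitive_root_of_unity t ((\<beta> ^ j) ^ N')"
    using primitive_root_power[OF \<xi>, of N'] pos by (simp add: MN)
  \<comment> \<open>The twist by \<open>x\<close> gives \<open>r ^ N' = \<eta> powi a\<close>
    whenever \<open>(p, r)\<close> in \<open>H\<close> has first exponent \<open>a\<close>, because
    \<open>N'\<close> powers see the second exponent only modulo \<open>t\<close>.\<close>
  define \<eta> where "\<eta> = ((\<beta> ^ j) ^ N') ^ x"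
  have \<eta>: "primitive_root_of_unity t \<eta>"
    unfolding \<eta>_def by (rule primitive_root_dvd_coprime_power[OF \<eta>0 t_dvd(4)])
  obtain s where s: "(\<alpha> ^ i) ^ M' = \<eta> ^ s"
    by (rule root_of_unity_is_power[OF \<eta>]) (use \<theta> in \<open>auto simp: primitive_root_of_unity_def\<close>)
  have "coprime s t"
  proof (rule ccontr)
    assume "\<not> coprime s t"
    then obtain r where r: "prime r" "r dvd s" "r dvd t"
      using prime_factor_nat[of "gcd s t"] by (auto simp: coprime_iff_gcd_eq_1)
    obtain s' t' where st: "s = r * s'" "t = r * t'" using r by (meson dvdE)
    have "((\<alpha> ^ i) ^ M') ^ t' = (\<eta> ^ t) ^ s'" unfolding s st by (simp add: mult_ac flip: power_mult)
    then have "((\<alpha> ^ i) ^ M') ^ t' = 1" using \<eta> by (simp add: primitive_root_of_unity_def)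
    then have "t dvd t'" using primitive_root_power_eq_1_iff[OF \<theta>] by simp
    then show False using st t_dvd(3) prime_gt_1_nat[OF r(1)] by (auto dest: dvd_imp_le)
  qed
  \<comment> \<open>Only the residue of \<open>s\<close> modulo \<open>t\<close> matters for powers
    of \<open>\<eta>\<close>, so \<open>s\<close> may be shifted to become coprime to
    \<open>M'\<close>.\<close>
  then obtain k where k: "k > 0" "coprime (s + t * k) M'"
    by (rule coprime_in_residue_class[OF _ pos(1)])
  define u where "u = s + t * k"
  have \<eta>u: "\<eta> ^ u = (\<alpha> ^ i) ^ M'"
    using \<eta> by (simp add: u_def s power_add power_mult primitive_root_of_unity_def)
  show ?thesis
  proof (rule that[of M' "N' * u"])
    show "M' > 0" "N' * u > 0" using pos k t_dvd(3) by (simp_all add: u_def)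
    show "coprime M' (N' * u)" using cop k(2) by (simp add: u_def coprime_commute)
    show "r ^ (N' * u) = p ^ M'" if pr: "(p, r) \<in> H" for p r
    proof -
      obtain a b where ab: "p = (\<alpha> ^ i) powi a" "r = (\<beta> ^ j) powi b" "[b = a * int x] (mod int t)"
        using pr by (rule H_memE)
      obtain e where e: "b = a * int x + int t * e"
        using ab(3) by (metis cong_iff_lin cong_sym)
      have "r ^ N' = ((\<beta> ^ j) ^ N') powi b"
        by (simp add: ab(2) power_int_power power_int_power' mult_ac)
      also have "\<dots> = ((\<beta> ^ j) ^ N') powi (a * int x) * ((\<beta> ^ j) ^ N') powi (int t * e)"
        using primitive_root_nonzero[OF \<eta>0] by (simp add: e power_int_add)
      also have "((\<beta> ^ j) ^ N') powi (int t * e) = 1"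
        using primitive_root_powi_eq_1_iff[OF \<eta>0] by simp
      also have "((\<beta> ^ j) ^ N') powi (a * int x) = \<eta> powi a"
        by (simp only: powi_mult_int \<eta>_def)
      finally have "r ^ (N' * u) = (\<eta> ^ u) powi a"
        by (simp add: power_mult power_int_power power_int_power' mult_ac)
      also have "\<dots> = p ^ M'"
        by (simp add: \<eta>u ab(1) power_int_power power_int_power' mult_ac)
      finally show ?thesis .
    qed
  qed
qed

subsection \<open>A valuation from nested radicals\<close>

text \<open>A fraction gets the value of its numerator minus that of its denominator;
  multiplicativity makes this independent of the representative, which is picked by choice.\<close>

lemma extend_valuation:
  fixes v :: "'a::idom \<Rightarrow> rat"
  assumes mult: "\<And>f g. f \<noteq> 0 \<Longrightarrow> g \<noteq> 0 \<Longrightarrow> v (f * g) = v f + v g"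
    and add: "\<And>f g. f \<noteq> 0 \<Longrightarrow> g \<noteq> 0 \<Longrightarrow> f + g \<noteq> 0 \<Longrightarrow> v (f + g) \<ge> min (v f) (v g)"
  obtains \<nu> where "valuation \<nu>" "\<And>f. f \<noteq> 0 \<Longrightarrow> \<nu> (to_fract f) = v f"
proof -
  define rep where "rep z = (SOME fg. snd fg \<noteq> 0 \<and> z = Fract (fst fg) (snd fg))" for z :: "'a fract"
  define \<nu> where "\<nu> z = v (fst (rep z)) - v (snd (rep z))" for z
  have \<nu>: "\<nu> (Fract f g) = v f - v g" if fg: "f \<noteq> 0" "g \<noteq> 0" for f g
  proof -
    have "\<exists>ab. snd ab \<noteq> 0 \<and> Fract f g = Fract (fst ab) (snd ab)" using fg by (intro exI[of _ "(f, g)"]) simp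
    from someI_ex[OF this] have r: "snd (rep (Fract f g)) \<noteq> 0"
      "Fract f g = Fract (fst (rep (Fract f g))) (snd (rep (Fract f g)))"
      by (simp_all add: rep_def)
    define a b where "a = fst (rep (Fract f g))" and "b = snd (rep (Fract f g))"
    have b: "b \<noteq> 0" and eq: "f * b = a * g" using r fg by (simp_all add: a_def b_def eq_fract)
    then have a: "a \<noteq> 0" using fg by auto
    have "v f + v b = v a + v g" using arg_cong[OF eq, of v] a b fg by (simp add: mult)
    then show ?thesis by (simp add: \<nu>_def flip: a_def b_def)
  qed
  have one: "v 1 = 0" using mult[of 1 1] by simp
  have "valuation \<nu>"
    unfolding valuation_def
  proof (intro conjI allI impI)
    fix x y :: "'a fract" assume xy: "x \<noteq> 0" "y \<noteq> 0"
    obtain a b where x: "x = Fract a b" "b \<noteq> 0" by (cases x)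
    obtain c e where y: "y = Fract c e" "e \<noteq> 0" by (cases y)
    have ac: "a \<noteq> 0" "c \<noteq> 0" using xy x y by (auto simp: fract_collapse)
    show "\<nu> (x * y) = \<nu> x + \<nu> y" using x y ac by (simp add: \<nu> mult)
    show "\<nu> (x + y) \<ge> min (\<nu> x) (\<nu> y)" if "x + y \<noteq> 0"
    proof -
      have xy: "x + y = Fract (a * e + c * b) (b * e)" using x y by simp
      then have 0: "a * e + c * b \<noteq> 0" using that by (auto simp: fract_collapse)
      have "\<nu> (x + y) = v (a * e + c * b) - v b - v e"
        unfolding xy using 0 x y by (simp add: \<nu> mult)
      moreover have "v (a * e + c * b) \<ge> min (v a + v e) (v c + v b)"
        using add[of "a * e" "c * b"] 0 ac x y by (simp add: mult)
      ultimately show ?thesis using x y ac by (simp add: \<nu>)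
    qed
  qed
  moreover have "\<nu> (to_fract f) = v f" if "f \<noteq> 0" for f
    using that by (simp add: to_fract_def \<nu> one)
  ultimately show ?thesis using that by blast
qed

lemma rational_rank_eq_1:
  assumes "1 \<in> \<Phi>"
  shows "rational_rank \<Phi> = 1"
proof -
  interpret vector_space "(*) :: rat \<Rightarrow> rat \<Rightarrow> rat"
    by unfold_locales (simp_all add: algebra_simps)
  show ?thesis
    unfolding rational_rank_def
  proof (rule dim_unique[of "{1}"])
    show "{1} \<subseteq> \<Phi>" using assms by simp
    show "\<Phi> \<subseteq> span {1}" by (auto simp: span_singleton)
    show "independent {1}" by simp
  qed simp
qed

text \<open>The system is solved from the inside out: dropping the outermost equation leaves a
  shorter one with shifted indices. Growth puts the inner radical above order
  \<open>D * c 0\<close>, so the outermost right side is \<open>fps_X ^ (D * c 0)\<close> times a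
  series with constant term 1. Both factors have a \<open>q 0\<close>-th root, the first because
  \<open>q 0\<close> divides \<open>D\<close>.\<close>

lemma nested_radicals:
  fixes c q :: "nat \<Rightarrow> nat"
  assumes "\<And>l. l < L \<Longrightarrow> q l > 0 \<and> q l dvd D"
    and "\<And>l. Suc l < L \<Longrightarrow> D * c l * q (Suc l) < D * c (Suc l)"
  shows "\<exists>z :: nat \<Rightarrow> 'k::field_char_0 fps. z L = 0 \<and>
    (\<forall>l<L. z l \<noteq> 0 \<and> z l ^ q l = fps_X ^ (D * c l) + z (Suc l) \<and> q l * subdegree (z l) = D * c l)"
  using assms
proof (induction L arbitrary: c q)
  case 0
  show ?case by (intro exI[of _ "\<lambda>_. 0"]) simp
next
  case (Suc L)
  obtain z' :: "nat \<Rightarrow> 'k fps" where z': "z' L = 0"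
    "\<And>l. l < L \<Longrightarrow> z' l \<noteq> 0 \<and> z' l ^ q (Suc l) = fps_X ^ (D * c (Suc l)) + z' (Suc l) \<and>
      q (Suc l) * subdegree (z' l) = D * c (Suc l)"
    using Suc.IH[of "\<lambda>l. q (Suc l)" "\<lambda>l. c (Suc l)"] Suc.prems by force
  have q0: "q 0 > 0" "q 0 dvd D" using Suc.prems by auto
  obtain y where y: "z' 0 = y * fps_X ^ (D * c 0)" "y $ 0 = 0"
  proof (cases "L = 0")
    case True
    then show ?thesis using z'(1) that[of 0] by simp
  next
    case False
    then have "q (Suc 0) * subdegree (z' 0) = D * c (Suc 0)" using z'(2)[of 0] by simp
    also have "\<dots> > q (Suc 0) * (D * c 0)" using Suc.prems(2)[of 0] False by (simp add: mult_ac)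
    finally have sub: "subdegree (z' 0) > D * c 0" by simp
    then have "z' 0 = fps_shift (D * c 0) (z' 0) * fps_X ^ (D * c 0)"
      by (simp add: fps_shift_times_fps_X_power)
    moreover have "z' 0 $ (D * c 0) = 0" using sub by (rule nth_less_subdegree_zero)
    then have "fps_shift (D * c 0) (z' 0) $ 0 = 0" by simp
    ultimately show ?thesis using that by blast
  qed
  define u where "u = fps_radical (\<lambda>_ _. 1) (q 0) (1 + y)"
  obtain k where k: "q 0 = Suc k" using q0 by (cases "q 0") auto
  have u: "u ^ q 0 = 1 + y" "u $ 0 = 1"
    using power_radical[of "1 + y" "\<lambda>_ _. 1" k] y(2) by (simp_all add: u_def k)
  obtain D' where D': "D = q 0 * D'" using q0(2) ..
  define z0 where "z0 = fps_X ^ (D' * c 0) * u"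
  have u0: "u \<noteq> 0" using u(2) by auto
  have "z0 ^ q 0 = fps_X ^ (D * c 0) + z' 0"
    using u(1) y(1) by (simp add: z0_def D' power_mult_distrib algebra_simps flip: power_mult)
  moreover have "z0 \<noteq> 0" using u0 by (simp add: z0_def)
  moreover have "q 0 * subdegree z0 = D * c 0"
    using u(2) u0 by (simp add: z0_def D' fps_X_power_subdegree)
  ultimately show ?case
    using z' by (intro exI[of _ "\<lambda>l. case l of 0 \<Rightarrow> z0 | Suc l' \<Rightarrow> z' l'"])
      (auto split: nat.split simp: less_Suc_eq_0_disj)
qed

text \<open>The series variable plays the part of a \<open>D\<close>-th root of X, so that
  fractional powers of X become integral.\<close>

definition eval_fps :: "nat \<Rightarrow> 'k fps \<Rightarrow> 'k::field poly poly \<Rightarrow> 'k fps" where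
  "eval_fps D y f = poly (map_poly (\<lambda>p. poly (map_poly fps_const p) (fps_X ^ D)) f) y"

lemma eval_fps_inner_morphism: "comm_ring_morphism (\<lambda>p. poly (map_poly fps_const p) (x :: 'k::field fps))"
proof -
  have "comm_ring_morphism (fps_const :: 'k \<Rightarrow> _)" by unfold_locales simp_all
  then show ?thesis
    by (intro comm_ring_morphism_comp[OF poly_morphism] comm_ring_morphism.map_poly_morphism)
qed

lemma eval_fps_morphism: "comm_ring_morphism (eval_fps D y)"
  unfolding eval_fps_def
  by (intro comm_ring_morphism_comp[OF poly_morphism] comm_ring_morphism.map_poly_morphism
      eval_fps_inner_morphism)

lemma eval_fps_varX: "eval_fps D y varX = fps_X ^ D"
  by (simp add: eval_fps_def varX_def map_poly_pCons)

lemma eval_fps_varY: "eval_fps D y varY = y"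
  by (simp add: eval_fps_def varY_def map_poly_pCons)

lemma eval_fps_const: "eval_fps D y [:[:c:]:] = fps_const c"
  by (simp add: eval_fps_def map_poly_pCons)

lemma eval_fps_smult: "eval_fps D y (smult [:c:] f) = fps_const c * eval_fps D y f"
  using comm_ring_morphism.hom_mult[OF eval_fps_morphism, of D y "[:[:c:]:]" f] by (simp add: eval_fps_const)

lemma eval_fps_nth_0:
  assumes "D > 0" "y $ 0 = 0"
  shows "eval_fps D y f $ 0 = coeff (coeff f 0) 0"
proof -
  have inner: "poly (map_poly fps_const p) (fps_X ^ D) $ 0 = coeff p 0" for p :: "'a poly"
    using assms(1) by (cases p) (simp add: map_poly_pCons)
  show ?thesis using assms(2)
    by (cases f) (simp add: eval_fps_def map_poly_pCons inner)
qed

section \<open>The tower of nested radicals and its valuation\<close>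

locale radical_tower =
  fixes K :: "'k::field_char_0 itself" and c q :: "nat \<Rightarrow> nat"
  assumes c_pos: "c l > 0" and q_pos: "q l > 0" and q_gt_1: "q (Suc l) > 1"
    and coprime_c_q: "coprime (c l) (q l)" and coprime_q: "k < l \<Longrightarrow> coprime (q k) (q l)"
    and growth: "c l * q (Suc l) < c (Suc l)"
begin

text \<open>When X has value 1, the two terms of the difference get equal values exactly if
  \<open>Q (Suc l)\<close> has value \<open>c l / q l\<close>. This fixes \<open>\<gamma>\<close>
  below and explains the index shift, shared by \<open>mb\<close>.\<close>

fun Q :: "nat \<Rightarrow> 'k poly poly" where
  "Q 0 = varX"
| "Q (Suc 0) = varY"
| "Q (Suc (Suc l)) = Q (Suc l) ^ q l - varX ^ c l"

definition \<gamma> :: "nat \<Rightarrow> rat" where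
  "\<gamma> l = (case l of 0 \<Rightarrow> 1 | Suc l' \<Rightarrow> of_nat (c l') / of_nat (q l'))"

definition mb :: "nat \<Rightarrow> nat" where "mb l = q (l - 1)"

lemma clear_denominators:
  "\<exists>A::int. of_nat (\<Prod>k<l. q k) * (\<Sum>k<Suc l. of_int (z k) * \<gamma> k) = of_int A"
proof (induction l)
  case 0
  show ?case by (intro exI[of _ "z 0"]) (simp add: \<gamma>_def)
next
  case (Suc l)
  then obtain A where A: "of_nat (\<Prod>k<l. q k) * (\<Sum>k<Suc l. of_int (z k) * \<gamma> k) = of_int A" by blast
  have "of_nat (\<Prod>k<Suc l. q k) * (\<Sum>k<Suc (Suc l). of_int (z k) * \<gamma> k) =
      of_nat (q l) * (of_nat (\<Prod>k<l. q k) * (\<Sum>k<Suc l. of_int (z k) * \<gamma> k)) +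
      of_nat (\<Prod>k<l. q k) * of_int (z (Suc l)) * (of_nat (q l) * \<gamma> (Suc l))"
    by (simp add: algebra_simps)
  also have "of_nat (q l) * \<gamma> (Suc l) = of_nat (c l)" using q_pos[of l] by (simp add: \<gamma>_def)
  finally show ?case unfolding A
    by (intro exI[of _ "int (q l) * A + int (\<Prod>k<l. q k) * z (Suc l) * int (c l)"]) simp
qed

text \<open>Minimality of \<open>mb\<close> comes from coprimality: the values before
  \<open>\<gamma> (Suc l)\<close> have a common denominator prime to \<open>q l\<close>, and so is
  \<open>c l\<close>, hence a multiplier of \<open>\<gamma> (Suc l)\<close> must absorb all of
  \<open>q l\<close>. The hypothesis \<open>growth\<close> yields the jump in values.\<close>

sublocale key_sequence Q mb \<gamma>
proof
  show "Q 0 = varX" "Q (Suc 0) = varY" by simp_all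
  show "mb l > 0" if "l \<ge> 1" for l by (simp add: mb_def q_pos)
  show "\<gamma> 0 > 0" "\<gamma> (Suc 0) > 0" by (simp_all add: \<gamma>_def c_pos q_pos)
  show "mb l \<le> a" if l: "l \<ge> 1" and a: "a > 0" and eq: "of_nat a * \<gamma> l = (\<Sum>k<l. of_int (z k) * \<gamma> k)" for l a z
  proof -
    obtain l' where l': "l = Suc l'" using l by (cases l) auto
    let ?P = "\<Prod>k<l'. q k"
    obtain A where A: "of_nat ?P * (\<Sum>k<l. of_int (z k) * \<gamma> k) = of_int A"
      using clear_denominators[of l' z] l' by auto
    have "of_nat (?P * a * c l') = of_nat ?P * (of_nat a * \<gamma> l) * of_nat (q l')"
      using q_pos[of l'] by (simp add: l' \<gamma>_def)
    also have "\<dots> = of_int (A * int (q l'))" unfolding eq A by simp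
    finally have "int (?P * a * c l') = A * int (q l')"
      by (metis of_int_eq_iff of_int_of_nat_eq)
    then have "int (q l') dvd int (?P * a * c l')" by simp
    then have "q l' dvd ?P * a * c l'" by (simp only: int_dvd_int_iff)
    moreover have "coprime (q l') ?P" using coprime_q by (intro prod_coprime_right) (simp add: coprime_commute)
    moreover have "coprime (q l') (c l')" using coprime_c_q by (simp add: coprime_commute)
    ultimately have "q l' dvd a"
      by (simp add: coprime_dvd_mult_left_iff coprime_dvd_mult_right_iff)
    then show ?thesis using a by (simp add: l' mb_def dvd_imp_le)
  qed
  show "\<exists>c' \<mu>. (\<forall>k. 1 \<le> k \<and> k < l \<longrightarrow> c' k < mb k) \<and>
      of_nat (mb l) * \<gamma> l = (\<Sum>k<l. of_nat (c' k) * \<gamma> k) \<and> \<mu> \<noteq> 0 \<and>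
      Q (Suc l) = Q l ^ mb l - smult [:\<mu>:] (\<Prod>k<l. Q k ^ c' k) \<and>
      \<gamma> (Suc l) > of_nat (mb l) * \<gamma> l" if l: "l \<ge> 1" for l
  proof -
    obtain l' where l': "l = Suc l'" using l by (cases l) auto
    \<comment> \<open>Only a power of X is subtracted, and its exponent is the one that reducedness
      leaves free.\<close>
    let ?c = "\<lambda>k. if k = 0 then c l' else 0 :: nat"
    have mbg: "of_nat (mb l) * \<gamma> l = of_nat (c l')" using q_pos[of l'] by (simp add: l' mb_def \<gamma>_def)
    show ?thesis
    proof (intro exI[of _ ?c] exI[of _ 1] conjI)
      show "\<forall>k. 1 \<le> k \<and> k < l \<longrightarrow> ?c k < mb k" by (simp add: mb_def q_pos)
      show "of_nat (mb l) * \<gamma> l = (\<Sum>k<l. of_nat (?c k) * \<gamma> k)"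
        unfolding mbg unfolding l' sum.lessThan_Suc_shift by (simp add: \<gamma>_def)
      have "(\<Prod>k<l. Q k ^ ?c k) = varX ^ c l'"
        unfolding l' prod.lessThan_Suc_shift by simp
      then show "Q (Suc l) = Q l ^ mb l - smult [:1:] (\<Prod>k<l. Q k ^ ?c k)"
        by (simp add: l' mb_def flip: one_pCons)
      have "of_nat (c l' * q l) < (of_nat (c l) :: rat)" using growth[of l'] l' by (simp del: of_nat_mult)
      then show "\<gamma> (Suc l) > of_nat (mb l) * \<gamma> l"
        unfolding mbg using q_pos[of l] by (simp add: \<gamma>_def field_simps)
    qed simp
  qed
qed

lemma jumps: "\<exists>l\<ge>L. mb l > 1"
  using q_gt_1[of L] by (intro exI[of _ "Suc (Suc L)"]) (simp add: mb_def)

definition denom :: "nat \<Rightarrow> nat" where "denom L = (\<Prod>k<L. q k)"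

lemma denom_pos: "denom L > 0"
  unfolding denom_def by (intro prod_pos) (simp add: q_pos)

text \<open>\<open>radicals L l\<close> is the truncation at depth \<open>L\<close> of the nested radical
  \<open>(X^c l + (X^c (l+1) + \<dots>)^(1/q (l+1)))^(1/q l)\<close>, as a power series in \<open>X^(1/denom L)\<close>.\<close>
definition radicals :: "nat \<Rightarrow> nat \<Rightarrow> 'k fps" where
  "radicals L = (SOME z. z L = 0 \<and> (\<forall>l<L. z l \<noteq> 0 \<and>
     z l ^ q l = fps_X ^ (denom L * c l) + z (Suc l) \<and> q l * subdegree (z l) = denom L * c l))"

lemma radicals:
  "radicals L L = (0 :: 'k fps)"
  "l < L \<Longrightarrow> radicals L l \<noteq> (0 :: 'k fps)"
  "l < L \<Longrightarrow> radicals L l ^ q l = fps_X ^ (denom L * c l) + (radicals L (Suc l) :: 'k fps)"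
  "l < L \<Longrightarrow> q l * subdegree (radicals L l :: 'k fps) = denom L * c l"
proof -
  have "\<exists>z :: nat \<Rightarrow> 'k fps. z L = 0 \<and> (\<forall>l<L. z l \<noteq> 0 \<and>
     z l ^ q l = fps_X ^ (denom L * c l) + z (Suc l) \<and> q l * subdegree (z l) = denom L * c l)"
  proof (rule nested_radicals)
    show "q l > 0 \<and> q l dvd denom L" if "l < L" for l
      unfolding denom_def using that q_pos by (auto intro: dvd_prodI)
    show "denom L * c l * q (Suc l) < denom L * c (Suc l)" for l
      using growth[of l] denom_pos[of L] by (simp add: mult.assoc)
  qed
  from someI_ex[OF this, folded radicals_def]
  show "radicals L L = (0 :: 'k fps)" "l < L \<Longrightarrow> radicals L l \<noteq> (0 :: 'k fps)"
    "l < L \<Longrightarrow> radicals L l ^ q l = fps_X ^ (denom L * c l) + (radicals L (Suc l) :: 'k fps)"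
    "l < L \<Longrightarrow> q l * subdegree (radicals L l :: 'k fps) = denom L * c l"
    by blast+
qed

definition \<phi> :: "nat \<Rightarrow> 'k poly poly \<Rightarrow> 'k fps" where
  "\<phi> L = eval_fps (denom L) (radicals L 0)"

lemma \<phi>_morphism: "comm_ring_morphism (\<phi> L)"
  by (simp add: \<phi>_def eval_fps_morphism)

text \<open>The recursion for \<open>Q\<close> undoes one radical at a time and leaves the inner
  part from level \<open>l\<close> on. At \<open>l = L\<close> this is 0, so depth \<open>L\<close>
  gives correct values only up to \<open>Q L\<close>.\<close>

lemma \<phi>_Q_Suc: "l \<le> L \<Longrightarrow> \<phi> L (Q (Suc l)) = radicals L l"
proof (induction l)
  case 0
  show ?case by (simp add: \<phi>_def eval_fps_varY)
next
  case (Suc l)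
  then have "\<phi> L (Q (Suc (Suc l))) = radicals L l ^ q l - (fps_X ^ denom L) ^ c l"
    by (simp add: comm_ring_morphism.hom_diff[OF \<phi>_morphism] comm_ring_morphism.hom_power[OF \<phi>_morphism])
      (simp add: \<phi>_def eval_fps_varX)
  then show ?case using Suc.prems by (simp add: radicals(3) power_mult)
qed

text \<open>Dividing by \<open>denom L\<close> gives X the order 1 at every depth, which makes
  different depths comparable.\<close>

definition ord :: "nat \<Rightarrow> 'k fps \<Rightarrow> rat" where
  "ord L g = of_nat (subdegree g) / of_nat (denom L)"

lemma ord_mult: "g \<noteq> 0 \<Longrightarrow> h \<noteq> 0 \<Longrightarrow> ord L (g * h) = ord L g + ord L h"
  by (simp add: ord_def add_divide_distrib)

lemma ord_power: "g \<noteq> 0 \<Longrightarrow> ord L (g ^ n) = of_nat n * ord L g"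
  by (simp add: ord_def)

lemma ord_add: "g + h \<noteq> 0 \<Longrightarrow> ord L (g + h) \<ge> min (ord L g) (ord L h)"
proof -
  assume "g + h \<noteq> 0"
  then have "subdegree g \<le> subdegree (g + h) \<or> subdegree h \<le> subdegree (g + h)"
    using subdegree_add_ge'[of g h] by (simp add: min_le_iff_disj)
  then have "ord L g \<le> ord L (g + h) \<or> ord L h \<le> ord L (g + h)"
    unfolding ord_def by (auto intro: divide_right_mono)
  then show ?thesis by (simp add: min_le_iff_disj)
qed

lemma \<phi>_Q:
  assumes "k \<le> L"
  shows "\<phi> L (Q k) \<noteq> 0" "ord L (\<phi> L (Q k)) = \<gamma> k"
proof (atomize (full), cases k)
  case 0
  then show "\<phi> L (Q k) \<noteq> 0 \<and> ord L (\<phi> L (Q k)) = \<gamma> k"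
    using denom_pos[of L] by (simp add: \<phi>_def eval_fps_varX ord_def \<gamma>_def fps_X_power_subdegree)
next
  case (Suc l)
  have "of_nat (q l) * of_nat (subdegree (radicals L l :: 'k fps)) = (of_nat (denom L) * of_nat (c l) :: rat)"
    using radicals(4)[of l L] Suc assms by (metis Suc_le_eq of_nat_mult)
  then show "\<phi> L (Q k) \<noteq> 0 \<and> ord L (\<phi> L (Q k)) = \<gamma> k"
    using Suc assms denom_pos[of L] q_pos[of l]
    by (simp add: \<phi>_Q_Suc radicals(2) ord_def \<gamma>_def field_simps)
qed

lemma \<phi>_mon:
  assumes "n \<le> Suc L"
  shows "\<phi> L (mon n e) \<noteq> 0 \<and> ord L (\<phi> L (mon n e)) = val n e"
  using assms
proof (induction n)
  case 0
  show ?case by (simp add: mon_def val_def comm_ring_morphism.hom_1[OF \<phi>_morphism] ord_def)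
next
  case (Suc n)
  have mon: "mon (Suc n) e = mon n e * Q n ^ e n" by (simp add: mon_def)
  have IH: "\<phi> L (mon n e) \<noteq> 0" "ord L (\<phi> L (mon n e)) = val n e" using Suc by auto
  have n: "n \<le> L" using Suc.prems by simp
  show ?case
    unfolding mon comm_ring_morphism.hom_mult[OF \<phi>_morphism] comm_ring_morphism.hom_power[OF \<phi>_morphism]
    using IH \<phi>_Q[OF n] by (simp add: ord_mult ord_power val_def)
qed

definition stable :: "'k poly poly \<Rightarrow> rat \<Rightarrow> bool" where
  "stable f r \<longleftrightarrow> (\<exists>L0. \<forall>L\<ge>L0. \<phi> L f \<noteq> 0 \<and> ord L (\<phi> L f) = r)"

text \<open>Expand \<open>f\<close> in reduced monomials in the \<open>Q k\<close> with
  \<open>k < n\<close>. From depth \<open>n\<close> on their orders are the distinct numbers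
  \<open>val n e\<close>, so the order of \<open>f\<close> is the least of these, whatever the
  depth.\<close>

lemma stable_exists:
  assumes "f \<noteq> 0"
  shows "\<exists>r. stable f r"
proof -
  obtain n where n: "n \<ge> 1" "degree f < d n" using d_unbounded[OF jumps] by blast
  obtain E k where E: "finite E" "E \<noteq> {}" "E \<subseteq> exponents n" "\<forall>e\<in>E. k e \<noteq> 0"
    "f = (\<Sum>e\<in>E. smult [:k e:] (mon n e))"
    using expansion[OF n assms] by (elim exE conjE)
  have "\<phi> L f \<noteq> 0 \<and> ord L (\<phi> L f) = Min (val n ` E)" if L: "L \<ge> n" for L
  proof -
    define T where "T e = fps_const (k e) * \<phi> L (mon n e)" for e
    have T: "T e \<noteq> 0 \<and> ord L (T e) = val n e" if "e \<in> E" for e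
      using \<phi>_mon[of n L e] L that E(4) by (simp add: T_def ord_mult) (simp add: ord_def)
    have f: "\<phi> L f = sum T E"
      unfolding E(5) comm_ring_morphism.hom_sum[OF \<phi>_morphism] T_def
      by (simp add: \<phi>_def eval_fps_smult)
    have "sum T E \<noteq> 0 \<and> ord L (sum T E) = Min ((\<lambda>e. ord L (T e)) ` E)"
    proof (rule ultrametric_sum[OF ord_add _ E(1,2)])
      show "inj_on (\<lambda>e. ord L (T e)) E"
        using inj_on_subset[OF val_inj E(3)] T by (simp add: inj_on_def)
    qed (use T in \<open>simp_all add: ord_def\<close>)
    moreover have "(\<lambda>e. ord L (T e)) ` E = val n ` E" using T by simp
    ultimately show ?thesis using f by simp
  qed
  then show ?thesis unfolding stable_def by blast
qed

definition v :: "'k poly poly \<Rightarrow> rat" where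
  "v f = (SOME r. stable f r)"

lemma v:
  assumes "f \<noteq> 0"
  obtains L0 where "\<And>L. L \<ge> L0 \<Longrightarrow> \<phi> L f \<noteq> 0 \<and> ord L (\<phi> L f) = v f"
proof -
  have "stable f (v f)" unfolding v_def by (rule someI_ex[OF stable_exists[OF assms]])
  then obtain L0 where "\<forall>L\<ge>L0. \<phi> L f \<noteq> 0 \<and> ord L (\<phi> L f) = v f" unfolding stable_def ..
  then show ?thesis by (intro that[of L0]) simp
qed

lemma v_mult:
  assumes "f \<noteq> 0" "g \<noteq> 0"
  shows "v (f * g) = v f + v g"
proof -
  obtain L1 where 1: "\<And>L. L \<ge> L1 \<Longrightarrow> \<phi> L f \<noteq> 0 \<and> ord L (\<phi> L f) = v f" using v[OF assms(1)] by blast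
  obtain L2 where 2: "\<And>L. L \<ge> L2 \<Longrightarrow> \<phi> L g \<noteq> 0 \<and> ord L (\<phi> L g) = v g" using v[OF assms(2)] by blast
  obtain L3 where 3: "\<And>L. L \<ge> L3 \<Longrightarrow> \<phi> L (f * g) \<noteq> 0 \<and> ord L (\<phi> L (f * g)) = v (f * g)"
    using v[of "f * g"] assms by auto
  define L where "L = max L1 (max L2 L3)"
  show ?thesis using 1[of L] 2[of L] 3[of L]
    by (simp add: L_def comm_ring_morphism.hom_mult[OF \<phi>_morphism] ord_mult)
qed

lemma v_add:
  assumes "f \<noteq> 0" "g \<noteq> 0" "f + g \<noteq> 0"
  shows "v (f + g) \<ge> min (v f) (v g)"
proof -
  obtain L1 where 1: "\<And>L. L \<ge> L1 \<Longrightarrow> \<phi> L f \<noteq> 0 \<and> ord L (\<phi> L f) = v f" using v[OF assms(1)] by blast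
  obtain L2 where 2: "\<And>L. L \<ge> L2 \<Longrightarrow> \<phi> L g \<noteq> 0 \<and> ord L (\<phi> L g) = v g" using v[OF assms(2)] by blast
  obtain L3 where 3: "\<And>L. L \<ge> L3 \<Longrightarrow> \<phi> L (f + g) \<noteq> 0 \<and> ord L (\<phi> L (f + g)) = v (f + g)"
    using v[OF assms(3)] by blast
  define L where "L = max L1 (max L2 L3)"
  have L: "L \<ge> L1" "L \<ge> L2" "L \<ge> L3" by (simp_all add: L_def)
  have hom: "\<phi> L (f + g) = \<phi> L f + \<phi> L g" by (rule comm_ring_morphism.hom_add[OF \<phi>_morphism])
  show ?thesis using ord_add[of "\<phi> L f" "\<phi> L g" L] 1[OF L(1)] 2[OF L(2)] 3[OF L(3)] by (simp add: hom)
qed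

lemma v_Q: "v (Q k) = \<gamma> k"
proof -
  obtain L0 where "\<And>L. L \<ge> L0 \<Longrightarrow> \<phi> L (Q k) \<noteq> 0 \<and> ord L (\<phi> L (Q k)) = v (Q k)"
    using v[OF Q_nonzero] by blast
  from this[of "max L0 k"] show ?thesis using \<phi>_Q[of k "max L0 k"] by simp
qed

lemma v_center:
  assumes "f \<noteq> 0"
  shows "v f \<ge> 0" "v f > 0 \<longleftrightarrow> f \<in> max_ideal_XY"
proof -
  obtain L where L: "\<phi> L f \<noteq> 0" "ord L (\<phi> L f) = v f" "L > 0"
  proof -
    obtain L0 where "\<And>L. L \<ge> L0 \<Longrightarrow> \<phi> L f \<noteq> 0 \<and> ord L (\<phi> L f) = v f" using v[OF assms] by blast
    from this[of "Suc L0"] show ?thesis using that[of "Suc L0"] by simp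
  qed
  show "v f \<ge> 0" unfolding L(2)[symmetric] ord_def by simp
  have "q 0 * subdegree (radicals L 0 :: 'k fps) > 0"
    using radicals(4)[of 0 L] L(3) denom_pos[of L] c_pos[of 0] by simp
  then have "(radicals L 0 :: 'k fps) $ 0 = 0" by (auto intro: nth_less_subdegree_zero)
  then have "\<phi> L f $ 0 = coeff (coeff f 0) 0"
    unfolding \<phi>_def using denom_pos by (intro eval_fps_nth_0) auto
  moreover have "v f > 0 \<longleftrightarrow> subdegree (\<phi> L f) > 0"
    unfolding L(2)[symmetric] ord_def using denom_pos[of L] by (simp add: zero_less_divide_iff)
  moreover have "subdegree (\<phi> L f) > 0 \<longleftrightarrow> \<phi> L f $ 0 = 0"
    using subdegree_eq_0_iff[of "\<phi> L f"] L(1) by auto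
  ultimately show "v f > 0 \<longleftrightarrow> f \<in> max_ideal_XY" by (simp add: mem_max_ideal_XY_iff)
qed

end

context radical_tower
begin

lemma realizing_valuation:
  obtains \<nu> where "rank1_nondiscrete_dominating \<nu>" "generating_sequence \<nu> Q"
proof -
  obtain \<nu> where \<nu>: "valuation \<nu>" "\<And>f. f \<noteq> 0 \<Longrightarrow> \<nu> (to_fract f) = v f"
    using extend_valuation[of v] v_mult v_add by blast
  have value_eq: "gs_value \<nu> Q = \<gamma>"
    by (rule ext) (simp add: gs_value_def \<nu>(2) Q_nonzero v_Q)
  have mbar: "gs_mbar \<nu> Q l = mb l" if l: "l \<ge> 1" for l
    unfolding gs_mbar_def value_eq
  proof (rule Least_equality)
    obtain e where "of_nat (mb l) * \<gamma> l = (\<Sum>k<l. of_nat (e k) * \<gamma> k)" using step[OF l] by blast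
    then have "of_nat (mb l) * \<gamma> l = (\<Sum>k<l. of_int (int (e k)) * \<gamma> k)" by simp
    then show "mb l > 0 \<and> (\<exists>z. of_nat (mb l) * \<gamma> l = (\<Sum>k<l. of_int (z k) * \<gamma> k))"
      using mb_pos[OF l] by (intro conjI exI)
  qed (use mb_least[OF l] in blast)
  have gen: "generating_sequence \<nu> Q"
    unfolding generating_sequence_def value_eq
  proof (intro conjI allI impI)
    fix l :: nat assume l: "1 \<le> l"
    obtain e \<mu> where e: "\<forall>k. 1 \<le> k \<and> k < l \<longrightarrow> e k < mb k"
      "of_nat (mb l) * \<gamma> l = (\<Sum>k<l. of_nat (e k) * \<gamma> k)" "\<mu> \<noteq> 0"
      "Q (Suc l) = Q l ^ mb l - smult [:\<mu>:] (\<Prod>k<l. Q k ^ e k)"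
      "\<gamma> (Suc l) > of_nat (mb l) * \<gamma> l"
      using step[OF l] by (elim exE conjE)
    show "\<exists>c \<mu>. (\<forall>k. 1 \<le> k \<and> k < l \<longrightarrow> c k < gs_mbar \<nu> Q k) \<and>
        of_nat (gs_mbar \<nu> Q l) * \<gamma> l = (\<Sum>k<l. of_nat (c k) * \<gamma> k) \<and> \<mu> \<noteq> 0 \<and>
        Q (Suc l) = Q l ^ gs_mbar \<nu> Q l - smult [:\<mu>:] (\<Prod>k<l. Q k ^ c k) \<and>
        of_nat (gs_mbar \<nu> Q l) * \<gamma> l < \<gamma> (Suc l)"
      unfolding mbar[OF l]
      by (rule exI[of _ e], rule exI[of _ \<mu>]) (use e mbar in simp)
  qed simp_all
  have \<gamma>_mem: "\<gamma> k \<in> value_group \<nu>" for k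
    unfolding value_group_def
    by (rule image_eqI[of _ _ "to_fract (Q k)"]) (simp_all add: \<nu>(2) Q_nonzero v_Q)
  have unit: "g \<noteq> 0 \<and> v g = 0" if "g \<notin> max_ideal_XY" for g
  proof -
    have "g \<noteq> 0" using that by (auto simp: mem_max_ideal_XY_iff)
    then show ?thesis using v_center[of g] that by simp
  qed
  have \<nu>_Fract: "\<nu> (Fract f g) = v f" if "f \<noteq> 0" "g \<notin> max_ideal_XY" for f g
    using that unit[OF that(2)] by (simp add: Fract_conv_to_fract valuation_divide[OF \<nu>(1)] \<nu>(2))
  have "dominates \<nu> R_loc R_loc_max"
    unfolding dominates_def
  proof (intro conjI equalityI subsetI)
    fix z :: "'k poly poly fract" assume "z \<in> R_loc"
    then obtain f g where z: "z = Fract f g" "g \<notin> max_ideal_XY"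
      by (auto simp: R_loc_def localization_def)
    show "z \<in> valuation_ring \<nu>"
      using z \<nu>_Fract[of f g] v_center(1)[of f] by (cases "f = 0") (simp_all add: valuation_ring_def fract_collapse)
  next
    fix z :: "'k poly poly fract" assume "z \<in> valuation_ideal \<nu> \<inter> R_loc"
    then obtain f g where z: "z = Fract f g" "g \<notin> max_ideal_XY" "z = 0 \<or> \<nu> z > 0"
      by (auto simp: R_loc_def localization_def valuation_ideal_def)
    have "f \<in> max_ideal_XY"
    proof (cases "f = 0")
      case True
      then show ?thesis by (simp add: mem_max_ideal_XY_iff)
    next
      case False
      then have "z \<noteq> 0" using z unit[OF z(2)] by (simp add: Zero_fract_def eq_fract)
      then show ?thesis using z(3) \<nu>_Fract[OF False z(2)] v_center(2)[OF False] by (simp add: z(1))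
    qed
    then show "z \<in> R_loc_max"
      using z unfolding R_loc_max_def localization_max_def by blast
  next
    fix z :: "'k poly poly fract" assume "z \<in> R_loc_max"
    then obtain f g where z: "z = Fract f g" "g \<notin> max_ideal_XY" "f \<in> max_ideal_XY"
      by (auto simp: R_loc_max_def localization_max_def)
    have "z \<in> R_loc" using z unfolding R_loc_def localization_def by blast
    moreover have "z \<in> valuation_ideal \<nu>"
      using z \<nu>_Fract[of f g] v_center(2)[of f]
      by (cases "f = 0") (simp_all add: valuation_ideal_def fract_collapse)
    ultimately show "z \<in> valuation_ideal \<nu> \<inter> R_loc" by blast
  qed
  moreover have "rational_rank (value_group \<nu>) = 1"
    using \<gamma>_mem[of 0] by (intro rational_rank_eq_1) (simp add: \<gamma>_def)
  \<comment> \<open>A generator \<open>A / B\<close> of the value group would have \<open>B\<close>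
    divisible by every \<open>q l\<close>, and by their products since they are pairwise coprime.
    These products are the degrees \<open>d\<close>, which are unbounded.\<close>
  moreover have "\<not> isomorphic_to_int (value_group \<nu>)"
  proof
    assume "isomorphic_to_int (value_group \<nu>)"
    then obtain h :: "int \<Rightarrow> rat" where h: "\<And>a b. h (a + b) = h a + h b" "bij_betw h UNIV (value_group \<nu>)"
      unfolding isomorphic_to_int_def by blast
    have h0: "h 0 = 0" using h(1)[of 0 0] by simp
    have hm: "h (- a) = - h a" for a using h(1)[of a "- a"] h0 by simp
    have hn: "h (int k) = of_nat k * h 1" for k
      by (induction k) (simp_all add: h0 h(1) algebra_simps)
    have hz: "h a = of_int a * h 1" for a
      using hn[of "nat a"] hn[of "nat (- a)"] hm[of "- a"] by (cases "a \<ge> 0") simp_all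
    obtain A B where AB: "quotient_of (h 1) = (A, B)" by force
    then have B: "B > 0" "h 1 = of_int A / of_int B"
      using quotient_of_denom_pos quotient_of_div by blast+
    have dvd: "int (q l) dvd B" for l
    proof -
      obtain s where s: "\<gamma> (Suc l) = h s" using \<gamma>_mem[of "Suc l"] h(2) by (auto simp: bij_betw_def)
      then have "of_nat (c l) / of_nat (q l) = of_int s * (of_int A / of_int B :: rat)"
        by (simp add: \<gamma>_def hz[of s] B(2))
      then have "of_int (int (c l) * B) = (of_int (s * A * int (q l)) :: rat)"
        using B(1) q_pos[of l] by (simp add: field_simps)
      then have "int (c l) * B = s * A * int (q l)" by (simp only: of_int_eq_iff)
      then have "int (q l) dvd int (c l) * B" by simp
      moreover have "coprime (int (q l)) (int (c l))" using coprime_c_q[of l] by (simp add: coprime_commute)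
      ultimately show ?thesis by (simp add: coprime_dvd_mult_right_iff)
    qed
    have prod_dvd: "int (\<Prod>k<L. q k) dvd B" for L
    proof (induction L)
      case (Suc L)
      have "coprime (\<Prod>k<L. q k) (q L)" using coprime_q by (intro prod_coprime_left) simp
      then have "coprime (int (\<Prod>k<L. q k)) (int (q L))" by (simp only: coprime_int_iff)
      then show ?case using divides_mult[OF Suc dvd[of L]] by simp
    qed simp
    have bound: "d (Suc L) \<le> nat B" for L
    proof -
      have mb_Suc: "mb (Suc k) = q k" for k by (simp add: mb_def)
      have "d (Suc L) = (\<Prod>k<L. q k)"
        by (induction L) (simp_all add: d_1 d_Suc mb_Suc mult.commute)
      moreover have "int (\<Prod>k<L. q k) \<le> B" using zdvd_imp_le[OF prod_dvd[of L] B(1)] .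
      ultimately have "int (d (Suc L)) \<le> B" by (simp only:)
      then show ?thesis by linarith
    qed
    obtain n where n: "n \<ge> 1" "nat B < d n" using d_unbounded[OF jumps] by blast
    show False using bound[of "n - 1"] n by simp
  qed
  ultimately have "rank1_nondiscrete_dominating \<nu>"
    using \<nu>(1) by (simp add: rank1_nondiscrete_dominating_def)
  then show ?thesis using gen by (rule that)
qed

text \<open>\<open>u\<close> is the common weight of all the powers \<open>varX ^ c l\<close>. The
  condition on \<open>q (Suc l)\<close> preserves it under the recursion, so every key polynomial
  from \<open>Q 2\<close> on has weight \<open>u\<close>.\<close>

lemma act_Q:
  assumes "r ^ q 0 = u" "\<And>l. p ^ c l = u" "\<And>l. u ^ q (Suc l) = u"
  shows "\<exists>a. act (p, r) (Q l) = smult [:a:] (Q l)"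
proof -
  have const: "[:a:] ^ k = [:a ^ k:]" for a :: 'k and k
    by (simp add: comm_ring_morphism.hom_power[OF const_poly_morphism])
  have X: "act (p, r) (varX ^ k) = smult [:p ^ k:] (varX ^ k)" for k
    by (simp add: comm_ring_morphism.hom_power[OF act_morphism] act_varX smult_power const)
  have main: "act (p, r) (Q (Suc (Suc l))) = smult [:u:] (Q (Suc (Suc l)))" for l
  proof (induction l)
    case 0
    show ?case
      by (simp add: comm_ring_morphism.hom_diff[OF act_morphism] X)
        (simp add: comm_ring_morphism.hom_power[OF act_morphism] act_varY smult_power const assms smult_diff_right)
  next
    case (Suc l)
    have "act (p, r) (Q (Suc (Suc l)) ^ q (Suc l)) = smult [:u:] (Q (Suc (Suc l)) ^ q (Suc l))"
      unfolding comm_ring_morphism.hom_power[OF act_morphism] Suc smult_power const assms ..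
    then show ?case
      by (simp only: Q.simps comm_ring_morphism.hom_diff[OF act_morphism] X assms smult_diff_right)
  qed
  consider "l = 0" | "l = Suc 0" | l' where "l = Suc (Suc l')" by (metis not0_implies_Suc)
  then show ?thesis
  proof cases
    case 1
    then show ?thesis by (auto simp: act_varX)
  next
    case 2
    then show ?thesis by (auto simp: act_varY)
  qed (use main in blast)
qed

end

text \<open>Fixing \<open>q\<close> and \<open>c\<close> modulo the orders of the group elements keeps all weights constant from
  \<open>Q 2\<close> on; \<open>tower_prod a q\<^sub>0 l\<close> is the product of the first \<open>l + 1\<close> values of \<open>tower_q\<close>.\<close>
fun tower_prod :: "nat \<Rightarrow> nat \<Rightarrow> nat \<Rightarrow> nat" where
  "tower_prod a q\<^sub>0 0 = q\<^sub>0"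
| "tower_prod a q\<^sub>0 (Suc l) = tower_prod a q\<^sub>0 l * (1 + a * tower_prod a q\<^sub>0 l)"

definition tower_q :: "nat \<Rightarrow> nat \<Rightarrow> nat \<Rightarrow> nat" where
  "tower_q a q\<^sub>0 l = (case l of 0 \<Rightarrow> q\<^sub>0 | Suc l' \<Rightarrow> 1 + a * tower_prod a q\<^sub>0 l')"

fun tower_c :: "nat \<Rightarrow> nat \<Rightarrow> nat \<Rightarrow> nat \<Rightarrow> nat \<Rightarrow> nat" where
  "tower_c b a q\<^sub>0 c\<^sub>0 0 = c\<^sub>0"
| "tower_c b a q\<^sub>0 c\<^sub>0 (Suc l) = c\<^sub>0 * (1 + b * tower_q a q\<^sub>0 (Suc l) * tower_c b a q\<^sub>0 c\<^sub>0 l)"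

lemma tower_q_dvd_prod: "k \<le> l \<Longrightarrow> tower_q a q\<^sub>0 k dvd tower_prod a q\<^sub>0 l"
proof (induction l)
  case (Suc l)
  show ?case
  proof (cases "k = Suc l")
    case True
    then show ?thesis by (simp only: tower_prod.simps tower_q_def nat.case dvd_triv_right)
  next
    case False
    then show ?thesis using Suc by simp
  qed
qed (simp add: tower_q_def)

text \<open>Each new \<open>q\<close> is 1 plus a multiple of \<open>e\<close>, of
  \<open>c\<^sub>0\<close> and of the product of the earlier ones, hence coprime to them. Each new
  \<open>c\<close> is \<open>c\<^sub>0\<close> times a number congruent to 1 modulo \<open>b\<close>
  and modulo the new \<open>q\<close>, and large enough for the growth condition.\<close>

lemma radical_tower_exists:
  fixes b e c\<^sub>0 q\<^sub>0 :: nat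
  assumes pos: "b > 0" "e > 0" "c\<^sub>0 > 0" "q\<^sub>0 > 0" and cop: "coprime c\<^sub>0 q\<^sub>0"
  obtains c q where "radical_tower c q" "c 0 = c\<^sub>0" "q 0 = q\<^sub>0"
    "\<And>l. [c l = c\<^sub>0] (mod b)" "\<And>l. [q (Suc l) = 1] (mod e)"
proof -
  define a where "a = b * e * c\<^sub>0"
  have a: "a > 0" using pos by (simp add: a_def)
  have P: "tower_prod a q\<^sub>0 l > 0" for l using pos by (induction l) simp_all
  have coprime_Suc: "coprime y (1 + z)" if "y dvd z" for y z :: nat
  proof (rule coprimeI)
    fix g assume "g dvd y" "g dvd 1 + z"
    then have "g dvd (1 + z) - z" using that by (intro dvd_diff_nat) (auto intro: dvd_trans)
    then show "g dvd 1" by simp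
  qed
  let ?q = "tower_q a q\<^sub>0" and ?c = "tower_c b a q\<^sub>0 c\<^sub>0"
  have q: "?q l > 0" for l using pos by (simp add: tower_q_def split: nat.split)
  have c: "?c l > 0" for l using pos by (induction l) simp_all
  have "radical_tower ?c ?q"
  proof
    show "?c l > 0" "?q l > 0" for l by (rule c q)+
    show "?q (Suc l) > 1" for l using a P[of l] by (simp add: tower_q_def)
    show "coprime (?c l) (?q l)" for l
    proof (cases l)
      case 0
      then show ?thesis using cop by (simp add: tower_q_def)
    next
      case (Suc l')
      have "coprime c\<^sub>0 (?q (Suc l'))"
        using coprime_Suc[of c\<^sub>0 "a * tower_prod a q\<^sub>0 l'"] by (simp add: tower_q_def a_def)
      moreover have "coprime (?q (Suc l')) (1 + b * ?q (Suc l') * ?c l')" by (rule coprime_Suc) simp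
      ultimately show ?thesis
        unfolding Suc tower_c.simps coprime_mult_left_iff by (simp only: coprime_commute)
    qed
    show "coprime (?q k) (?q l)" if kl: "k < l" for k l
    proof -
      obtain l' where l': "l = Suc l'" "k \<le> l'" using kl by (cases l) auto
      have "?q k dvd a * tower_prod a q\<^sub>0 l'" using tower_q_dvd_prod[OF l'(2)] by simp
      then show ?thesis using coprime_Suc by (simp add: l' tower_q_def)
    qed
    show "?c l * ?q (Suc l) < ?c (Suc l)" for l
    proof -
      let ?y = "?c l * ?q (Suc l)"
      have "?y \<le> b * ?y" using pos(1) by simp
      also have "\<dots> < 1 * (1 + b * ?q (Suc l) * ?c l)" by (simp add: mult_ac)
      also have "\<dots> \<le> ?c (Suc l)"
        unfolding tower_c.simps by (rule mult_le_mono1) (use pos(3) in simp)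
      finally show ?thesis .
    qed
  qed
  moreover have "?c 0 = c\<^sub>0" "?q 0 = q\<^sub>0" by (simp_all add: tower_q_def)
  moreover have "[?c l = c\<^sub>0] (mod b)" for l
  proof (cases l)
    case (Suc l')
    have "?c l = c\<^sub>0 + b * (c\<^sub>0 * ?q (Suc l') * ?c l')" by (simp add: Suc algebra_simps)
    then show ?thesis by (simp add: cong_def)
  qed simp
  moreover have "[?q (Suc l) = 1] (mod e)" for l
  proof -
    have "?q (Suc l) = 1 + e * (b * c\<^sub>0 * tower_prod a q\<^sub>0 l)" by (simp add: tower_q_def a_def algebra_simps)
    then show ?thesis by (simp only: cong_def mod_mult_self2)
  qed
  ultimately show ?thesis by (rule that)
qed

lemma power_cong_exponent:
  fixes z :: "'a::monoid_mult"
  assumes "z ^ b = 1" "[k = l] (mod b)"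
  shows "z ^ k = z ^ l"
proof -
  have "z ^ k = z ^ (k mod b)" for k
  proof -
    have "z ^ k = z ^ (b * (k div b) + k mod b)" by simp
    also have "\<dots> = (z ^ b) ^ (k div b) * z ^ (k mod b)" unfolding power_add power_mult ..
    finally show ?thesis by (simp add: assms(1))
  qed
  then show ?thesis using assms(2) unfolding cong_def by metis
qed

theorem theorem0p2:
  fixes \<alpha> \<beta> :: "'k::{alg_closed_field, field_char_0}"
    and m n i j t x :: nat
  assumes "m > 0" and "n > 0"
    and "primitive_root_of_unity m \<alpha>"
    and "primitive_root_of_unity n \<beta>"
    and "admissible m n i j t x"
  shows "((\<exists>(\<nu> :: 'k poly poly fract \<Rightarrow> rat) Q.
            rank1_nondiscrete_dominating \<nu> \<and> generating_sequence \<nu> Q \<and>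
            (\<forall>l. eigenfunction (H_group \<alpha> \<beta> i j t x) (Q l)))
         \<longleftrightarrow> gcd (m div i) (n div j) = t) \<and>
        (gcd (m div i) (n div j) = t \<and> t = 1 \<longrightarrow>
         (\<forall>(\<nu> :: 'k poly poly fract \<Rightarrow> rat) Q.
            rank1_nondiscrete_dominating \<nu> \<and> generating_sequence \<nu> Q \<and>
            (\<forall>l. eigenfunction (H_group \<alpha> \<beta> i j t x) (Q l)) \<longrightarrow>
            finitely_generated_over (value_semigroup R_loc \<nu>)
              (value_semigroup (A_loc (H_group \<alpha> \<beta> i j t x)) \<nu>))) \<and>
        (gcd (m div i) (n div j) = t \<and> t > 1 \<longrightarrow>
         (\<forall>(\<nu> :: 'k poly poly fract \<Rightarrow> rat) Q.
            rank1_nondiscrete_dominating \<nu> \<and> generating_sequence \<nu> Q \<and>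
            (\<forall>l. eigenfunction (H_group \<alpha> \<beta> i j t x) (Q l)) \<longrightarrow>
            \<not> finitely_generated_over (value_semigroup R_loc \<nu>)
              (value_semigroup (A_loc (H_group \<alpha> \<beta> i j t x)) \<nu>)))"
proof -
  interpret group_data \<alpha> \<beta> m n i j t x using assms(3-5) by unfold_locales
  have eigen: "eigen_data \<alpha> \<beta> m n i j t x \<nu> Q"
    if "rank1_nondiscrete_dominating \<nu> \<and> generating_sequence \<nu> Q \<and> (\<forall>l. eigenfunction H (Q l))" for \<nu> Q
    using that by unfold_locales auto
  have exists: "\<exists>(\<nu> :: 'k poly poly fract \<Rightarrow> rat) Q. rank1_nondiscrete_dominating \<nu> \<and>
      generating_sequence \<nu> Q \<and> (\<forall>l. eigenfunction H (Q l))" if gcd: "gcd M N = t"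
  proof -
    obtain c\<^sub>0 q\<^sub>0 where cq: "c\<^sub>0 > 0" "q\<^sub>0 > 0" "coprime c\<^sub>0 q\<^sub>0"
      "\<And>p r. (p, r) \<in> H \<Longrightarrow> r ^ q\<^sub>0 = p ^ c\<^sub>0"
      using compatible_exponents[OF gcd] by metis
    \<comment> \<open>On \<open>H\<close>, exponents of \<open>p\<close> matter only modulo
      \<open>M\<close> and those of \<open>r\<close> only modulo \<open>N\<close>, so with these
      congruences every later subtraction has the same weight as the first.\<close>
    obtain c q where tower: "radical_tower c q" "c 0 = c\<^sub>0" "q 0 = q\<^sub>0"
      "\<And>l. [c l = c\<^sub>0] (mod M)" "\<And>l. [q (Suc l) = 1] (mod N)"
      using radical_tower_exists[OF M_pos N_pos cq(1-3)] by metis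
    interpret radical_tower "TYPE('k)" c q by (rule tower(1))
    obtain \<nu> where \<nu>: "rank1_nondiscrete_dominating \<nu>" "generating_sequence \<nu> Q"
      by (rule realizing_valuation)
    have "eigenfunction H (Q l)" for l
      unfolding eigenfunction_def
    proof
      fix g assume "g \<in> H"
      moreover obtain p r where g: "g = (p, r)" by (cases g)
      ultimately have pr: "(p, r) \<in> H" by simp
      note powers = H_powers[OF pr]
      have "\<exists>a. act (p, r) (Q l) = smult [:a:] (Q l)"
      proof (rule act_Q)
        show "r ^ q 0 = r ^ q\<^sub>0" by (simp add: tower(3))
        show "p ^ c l = r ^ q\<^sub>0" for l
          using power_cong_exponent[OF powers(1) tower(4)] cq(4)[OF pr] by simp
        show "(r ^ q\<^sub>0) ^ q (Suc l) = r ^ q\<^sub>0" for l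
        proof -
          have "(r ^ q\<^sub>0) ^ N = 1" using powers(2) by (metis power_mult mult.commute power_one)
          from power_cong_exponent[OF this tower(5)] show ?thesis by simp
        qed
      qed
      then show "\<exists>a. act g (Q l) = smult [:a:] (Q l)" by (simp add: g)
    qed
    then show ?thesis using \<nu> by blast
  qed
  show ?thesis
    using exists eigen_data.gcd_eq[OF eigen] eigen_data.fg_if_trivial[OF eigen]
      eigen_data.not_fg_if_nontrivial[OF eigen]
    by (intro conjI iffI impI allI) (elim exE conjE, simp_all)
qed

end
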